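(* Suppose $g(x_1,\dots,x_n)$ is a real analytic function defined on a neighborhood of the origin, not identically zero. Then there is an $(n-1)$-dimensional ball $B_{n-1}(0,\eta)$ and a $k\ge 0$ such that for each $(x_1,\dots,x_{n-1})$ in $B_{n-1}(0,\eta)$ either $g(x_1,\dots,x_n)=0$ for all $|x_n|<\eta$, or there is an $l$ with $0\le l\le k$, which may depend on $(x_1,\dots,x_{n-1})$, such that for all $|x_n|<\eta$ one has $$0<\tfrac12\left|\partial_{x_n}^l g(x_1,\dots,x_{n-1},0)\right|<\left|\partial_{x_n}^l g(x_1,\dots,x_n)\right|<2\left|\partial_{x_n}^l g(x_1,\dots,x_{n-1},0)\right|.$$ The set of $(x_1,\dots,x_{n-1})$ for which $g(x_1,\dots,x_n)=0$ for all $|x_n|<\eta$ has measure zero.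
   Context: The neighborhood of the origin is in $\mathbb{R}^n$. $B_{n-1}(0,\eta)$ denotes the ball of radius $\eta>0$ centered at the origin in $\mathbb{R}^{n-1}$; $k$ and $l$ are integers, and $\partial_{x_n}^l$ is the $l$-th partial derivative in $x_n$ (with $\partial_{x_n}^0 g=g$). In the last sentence, the points $(x_1,\dots,x_{n-1})$ range over $B_{n-1}(0,\eta)$ and measure means $(n-1)$-dimensional Lebesgue measure.
   Formalization: The neighborhood of the origin is taken to be open and connected; on a disconnected one, a function vanishing near the origin but not on another component would violate the measure-zero claim. *)

theory Defs
  imports "HOL-Analysis.Analysis"
begin

text \<open>
  The statement relates \<open>n\<close>-dimensional to \<open>(n - 1)\<close>-dimensional space, and \<open>n = 1\<close> is allowed,
  so a point of \<open>n\<close>-space is an extensional function \<open>x\<close> on \<open>{1..n}\<close> with coordinates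
  \<open>x 1, \<dots>, x n\<close>; for \<open>n = 0\<close> there is exactly one point. If \<open>x\<close> is a point of \<open>(n - 1)\<close>-space
  and \<open>n \<ge> 1\<close>, then \<open>x(n := t)\<close> is the point \<open>(x 1, \<dots>, x (n - 1), t)\<close> of \<open>n\<close>-space.
\<close>

definition Rn :: "nat \<Rightarrow> (nat \<Rightarrow> real) set" where
  "Rn n = ({1..n} \<rightarrow>\<^sub>E UNIV)"

definition Rn_origin :: "nat \<Rightarrow> nat \<Rightarrow> real" where
  "Rn_origin n = (\<lambda>i\<in>{1..n}. 0)"

definition Rn_topology :: "nat \<Rightarrow> (nat \<Rightarrow> real) topology" where
  "Rn_topology n = product_topology (\<lambda>_. euclideanreal) {1..n}"

definition Rn_ball :: "nat \<Rightarrow> (nat \<Rightarrow> real) \<Rightarrow> real \<Rightarrow> (nat \<Rightarrow> real) set" where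
  "Rn_ball n a r = {x \<in> Rn n. L2_set (\<lambda>i. x i - a i) {1..n} < r}"

text \<open>For \<open>n = 0\<close> this is the unit mass at the only point.\<close>

definition Rn_lebesgue :: "nat \<Rightarrow> (nat \<Rightarrow> real) measure" where
  "Rn_lebesgue n = completion (\<Pi>\<^sub>M i\<in>{1..n}. lborel)"

text \<open>
  The series runs over all multi-indices \<open>\<alpha>\<close> of length \<open>n\<close>. Real-valued \<open>has_sum\<close> is absolute
  convergence, so no enumeration of the multi-indices is involved. As with the library's
  \<open>analytic_on\<close>, the expansion is required on a full ball around each point of \<open>U\<close>; for open
  \<open>U\<close> the values of \<open>g\<close> outside \<open>U\<close> are irrelevant, since the ball can be shrunk.
\<close>

definition real_analytic_on :: "nat \<Rightarrow> ((nat \<Rightarrow> real) \<Rightarrow> real) \<Rightarrow> (nat \<Rightarrow> real) set \<Rightarrow> bool" where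
  "real_analytic_on n g U \<longleftrightarrow>
     (\<forall>a\<in>U. \<exists>r>0. \<exists>c :: (nat \<Rightarrow> nat) \<Rightarrow> real. \<forall>x\<in>Rn_ball n a r.
        ((\<lambda>\<alpha>. c \<alpha> * (\<Prod>i\<in>{1..n}. (x i - a i) ^ \<alpha> i)) has_sum g x) ({1..n} \<rightarrow>\<^sub>E UNIV))"

definition partial_deriv :: "nat \<Rightarrow> ((nat \<Rightarrow> real) \<Rightarrow> real) \<Rightarrow> (nat \<Rightarrow> real) \<Rightarrow> real" where
  "partial_deriv j g x = deriv (\<lambda>s. g (x(j := s))) (x j)"

end

theory Submission
  imports Defs "HOL-Complex_Analysis.Conformal_Mappings" "HOL-Computational_Algebra.Primes"
begin

text \<open>
  Expand \<open>g\<close> at the origin as \<open>\<Sum>j. b\<^sub>j(x) t^j\<close>, where \<open>x\<close> collects the first \<open>n - 1\<close> variables. If for some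
  \<open>k\<close> all \<open>j\<close> satisfy \<open>\<bar>b\<^sub>j(x)\<bar> \<le> C R^j (\<bar>b\<^sub>0(x)\<bar> + \<dots> + \<bar>b\<^sub>k(x)\<bar>)\<close> uniformly for small \<open>x\<close>, then the index \<open>l \<le> k\<close>
  maximising \<open>\<bar>b\<^sub>l(x)\<bar>\<close> works: either all \<open>b\<^sub>j(x)\<close> vanish, or the \<open>l\<close>-th derivative in \<open>t\<close> is nearly
  constant on an interval whose length does not depend on \<open>x\<close>.

  The uniform bound is a quantitative form of the Noetherian property. Encode the multi-index
  \<open>\<alpha>\<close> by \<open>N = p\<^sub>1^\<alpha>\<^sub>1 p\<^sub>2^\<alpha>\<^sub>2 \<dots>\<close> with distinct primes. This orders the monomials linearly and
  compatibly with multiplication, and turns the weighted \<open>\<ell>\<^sup>1\<close> norms into \<open>\<Sum>N. \<bar>f N\<bar> / N^\<sigma>\<close>, in which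
  the leading term of any given series dominates its tail once \<open>\<sigma>\<close> is large. Consider all \<open>f\<close> with
  \<open>\<bar>f(x)\<bar> \<le> C (\<bar>b\<^sub>0(x)\<bar> + \<dots> + \<bar>b\<^sub>k(x)\<bar>)\<close> near \<open>0\<close> for some \<open>C\<close> and \<open>k\<close>. By Dickson's lemma the leading
  exponents of these \<open>f\<close> are multiples of those of finitely many of them, and dividing \<open>b\<^sub>j\<close> by these leaves
  a remainder which again satisfies such a bound but has no admissible leading exponent, hence is \<open>0\<close>.

  The zero set of a nonzero power series is null by induction on the dimension and Fubini. This
  also gives the identity theorem, by which \<open>g\<close> is not identically zero near the origin.
\<close>

section \<open>Absolutely convergent sums and triangular systems of infinite size\<close>

lemma summable_on_real_comparison:
  fixes f g :: "'a \<Rightarrow> real"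
  assumes "g summable_on A" "\<And>x. x \<in> A \<Longrightarrow> \<bar>f x\<bar> \<le> g x"
  shows "f summable_on A"
proof -
  have "(\<lambda>x. norm (f x)) summable_on A"
    by (rule summable_on_comparison_test[OF assms(1)]) (use assms(2) in auto)
  then show ?thesis by (rule abs_summable_summable)
qed

lemma abs_infsum_le:
  fixes f g :: "'a \<Rightarrow> real"
  assumes "g summable_on A" "\<And>x. x \<in> A \<Longrightarrow> \<bar>f x\<bar> \<le> g x"
  shows "\<bar>infsum f A\<bar> \<le> infsum g A"
  using norm_infsum_le[OF has_sum_infsum has_sum_infsum, OF summable_on_real_comparison[OF assms] assms(1)]
    assms(2) by simp

text \<open>
  Recursion on \<open>M\<close> gives \<open>h\<close>. Since \<open>G N\<close> outside its diagonal entry has at most half the weight of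
  that entry, the partial sums of \<open>\<bar>h N\<bar> * w N\<close> are at most the norm of \<open>f\<close> plus half of themselves.
\<close>

lemma triangular_reduction:
  fixes S D :: "nat set" and w f :: "nat \<Rightarrow> real" and G :: "nat \<Rightarrow> nat \<Rightarrow> real"
  assumes DS: "D \<subseteq> S" and w: "\<And>N. N \<in> S \<Longrightarrow> w N > 0"
    and f: "(\<lambda>M. \<bar>f M\<bar> * w M) summable_on S"
    and diag: "\<And>N. N \<in> D \<Longrightarrow> G N N = 1"
    and Gsum: "\<And>N. N \<in> D \<Longrightarrow> (\<lambda>M. \<bar>G N M\<bar> * w M) summable_on S"
    and tail: "\<And>N. N \<in> D \<Longrightarrow> infsum (\<lambda>M. \<bar>G N M\<bar> * w M) (S - {N}) \<le> 1/2 * w N"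
  obtains h where "(\<lambda>N. \<bar>h N\<bar> * w N) summable_on D"
    and "infsum (\<lambda>N. \<bar>h N\<bar> * w N) D \<le> 2 * infsum (\<lambda>M. \<bar>f M\<bar> * w M) S"
    and "\<And>M. M \<in> D \<Longrightarrow> (\<Sum>N\<in>{N\<in>D. N \<le> M}. h N * G N M) = f M"
proof -
  have w0: "0 \<le> \<bar>c\<bar> * w N" if "N \<in> S" for c :: real and N
    using w[OF that] by simp
  define F where "F = (\<lambda>(h :: nat \<Rightarrow> real) M. f M - (\<Sum>N\<in>{N\<in>D. N < M}. h N * G N M))"
  define h where "h = wfrec less_than F"
  have h_eq: "h M = f M - (\<Sum>N\<in>{N\<in>D. N < M}. h N * G N M)" for M
  proof -
    have "h M = F (cut h less_than M) M"
      unfolding h_def by (rule wfrec) simp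
    also have "\<dots> = f M - (\<Sum>N\<in>{N\<in>D. N < M}. h N * G N M)"
      unfolding F_def by (auto simp: cut_apply intro!: sum.cong)
    finally show ?thesis .
  qed
  let ?n = "infsum (\<lambda>M. \<bar>f M\<bar> * w M) S"
  \<comment> \<open>Cutting off at \<open>X\<close> keeps the sum finite, so half of it can be moved
    to the left-hand side. The bound is independent of \<open>X\<close>, which later gives
    summability.\<close>
  have bound: "(\<Sum>M\<in>{M\<in>D. M < X}. \<bar>h M\<bar> * w M) \<le> 2 * ?n" for X
  proof -
    define DX where "DX = {M\<in>D. M < X}"
    have fin: "finite DX" and DXS: "DX \<subseteq> S" and DXD: "DX \<subseteq> D"
      unfolding DX_def using DS by auto
    have "(\<Sum>M\<in>DX. \<bar>h M\<bar> * w M)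
        \<le> (\<Sum>M\<in>DX. \<bar>f M\<bar> * w M + (\<Sum>N\<in>DX. if N < M then \<bar>h N\<bar> * (\<bar>G N M\<bar> * w M) else 0))"
    proof (rule sum_mono)
      fix M assume M: "M \<in> DX"
      then have wM: "w M > 0" using w DXS by auto
      have "\<bar>h M\<bar> \<le> \<bar>f M\<bar> + \<bar>\<Sum>N\<in>{N\<in>D. N < M}. h N * G N M\<bar>"
        by (subst h_eq) linarith
      also have "\<bar>\<Sum>N\<in>{N\<in>D. N < M}. h N * G N M\<bar> \<le> (\<Sum>N\<in>{N\<in>D. N < M}. \<bar>h N\<bar> * \<bar>G N M\<bar>)"
        by (rule order.trans[OF sum_abs]) (simp add: abs_mult)
      finally have "\<bar>h M\<bar> * w M \<le> (\<bar>f M\<bar> + (\<Sum>N\<in>{N\<in>D. N < M}. \<bar>h N\<bar> * \<bar>G N M\<bar>)) * w M"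
        using wM by simp
      also have "\<dots> = \<bar>f M\<bar> * w M + (\<Sum>N\<in>{N\<in>D. N < M}. \<bar>h N\<bar> * (\<bar>G N M\<bar> * w M))"
        by (simp add: distrib_right sum_distrib_right mult.assoc)
      also have "(\<Sum>N\<in>{N\<in>D. N < M}. \<bar>h N\<bar> * (\<bar>G N M\<bar> * w M))
          = (\<Sum>N\<in>DX. if N < M then \<bar>h N\<bar> * (\<bar>G N M\<bar> * w M) else 0)"
        using M by (intro sum.mono_neutral_cong_left fin) (auto simp: DX_def)
      finally show "\<bar>h M\<bar> * w M \<le>
        \<bar>f M\<bar> * w M + (\<Sum>N\<in>DX. if N < M then \<bar>h N\<bar> * (\<bar>G N M\<bar> * w M) else 0)" .
    qed
    also have "\<dots> = (\<Sum>M\<in>DX. \<bar>f M\<bar> * w M)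
        + (\<Sum>N\<in>DX. \<bar>h N\<bar> * (\<Sum>M\<in>DX. if N < M then \<bar>G N M\<bar> * w M else 0))"
      by (subst sum.distrib, subst sum.swap) (simp add: sum_distrib_left if_distrib cong: if_cong)
    also have "\<dots> \<le> ?n + (\<Sum>N\<in>DX. \<bar>h N\<bar> * (1/2 * w N))"
    proof (intro add_mono sum_mono mult_left_mono)
      show "(\<Sum>M\<in>DX. \<bar>f M\<bar> * w M) \<le> ?n"
        by (rule finite_sum_le_infsum[OF f fin DXS]) (use w0 in auto)
      fix N assume N: "N \<in> DX"
      have "(\<Sum>M\<in>DX. if N < M then \<bar>G N M\<bar> * w M else 0) = (\<Sum>M\<in>{M\<in>DX. N < M}. \<bar>G N M\<bar> * w M)"
        using fin by (intro sum.mono_neutral_cong_right) auto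
      also have "\<dots> \<le> infsum (\<lambda>M. \<bar>G N M\<bar> * w M) (S - {N})"
        using N fin DXS DXD w0
        by (intro finite_sum_le_infsum summable_on_subset_banach[OF Gsum]) auto
      also have "\<dots> \<le> 1/2 * w N" using tail N DXD by auto
      finally show "(\<Sum>M\<in>DX. if N < M then \<bar>G N M\<bar> * w M else 0) \<le> 1/2 * w N" .
    qed simp
    also have "(\<Sum>N\<in>DX. \<bar>h N\<bar> * (1/2 * w N)) = 1/2 * (\<Sum>N\<in>DX. \<bar>h N\<bar> * w N)"
      by (simp add: sum_distrib_left algebra_simps)
    finally show ?thesis unfolding DX_def by simp
  qed
  have fin_bound: "sum (\<lambda>N. \<bar>h N\<bar> * w N) F \<le> 2 * ?n" if "F \<subseteq> D" "finite F" for F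
  proof -
    have "sum (\<lambda>N. \<bar>h N\<bar> * w N) F \<le> (\<Sum>M\<in>{M\<in>D. M < Suc (Max F)}. \<bar>h M\<bar> * w M)"
      using that w0 DS by (intro sum_mono2) (auto simp: less_Suc_eq_le subset_iff)
    then show ?thesis using bound by (rule order.trans)
  qed
  have summ: "(\<lambda>N. \<bar>h N\<bar> * w N) summable_on D"
    using fin_bound w0 DS
    by (intro nonneg_bdd_above_summable_on bdd_aboveI2[where M="2 * ?n"]) auto
  moreover have "infsum (\<lambda>N. \<bar>h N\<bar> * w N) D \<le> 2 * ?n"
    by (rule infsum_le_finite_sums[OF summ]) (use fin_bound in auto)
  moreover have "(\<Sum>N\<in>{N\<in>D. N \<le> M}. h N * G N M) = f M" if "M \<in> D" for M
  proof -
    have "{N\<in>D. N \<le> M} = insert M {N\<in>D. N < M}" using that by auto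
    then have "(\<Sum>N\<in>{N\<in>D. N \<le> M}. h N * G N M) = h M + (\<Sum>N\<in>{N\<in>D. N < M}. h N * G N M)"
      using diag that by simp
    then show ?thesis using h_eq[of M] by simp
  qed
  ultimately show thesis by (rule that)
qed

subsection \<open>Division by finitely many series\<close>

lemma has_sum_reindex_neutral:
  assumes "inj_on g B" "g ` B \<subseteq> A" "\<And>x. x \<in> A - g ` B \<Longrightarrow> h x = 0"
  shows "(h has_sum s) A \<longleftrightarrow> ((\<lambda>y. h (g y)) has_sum s) B"
proof -
  have "(h has_sum s) A \<longleftrightarrow> (h has_sum s) (g ` B)"
    using assms(2,3) by (intro has_sum_cong_neutral) auto
  also have "\<dots> \<longleftrightarrow> ((\<lambda>y. h (g y)) has_sum s) B"
    using has_sum_reindex[OF assms(1), of h s] by (simp add: o_def)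
  finally show ?thesis .
qed

text \<open>
  \<open>S\<close> is the set of codes of multi-indices, so that \<open>e x N\<close> is the value at \<open>x\<close> of the monomial with
  code \<open>N\<close>, and \<open>dickson\<close> is Dickson's lemma.
\<close>

locale dirichlet_evaluation =
  fixes S :: "nat set" and e :: "'x \<Rightarrow> nat \<Rightarrow> real"
  assumes S_pos: "N \<in> S \<Longrightarrow> 0 < N"
    and S_mult: "M \<in> S \<Longrightarrow> N \<in> S \<Longrightarrow> M * N \<in> S"
    and e_mult: "M \<in> S \<Longrightarrow> N \<in> S \<Longrightarrow> e x (M * N) = e x M * e x N"
    and dickson: "A \<subseteq> S \<Longrightarrow> \<exists>F. finite F \<and> F \<subseteq> A \<and> (\<forall>a\<in>A. \<exists>d\<in>F. \<exists>q\<in>S. a = q * d)"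
begin

section \<open>Weighted norms, polydiscs and values of a series\<close>

definition wt :: "nat \<Rightarrow> nat \<Rightarrow> real" where
  "wt \<sigma> N = (1 / real N) ^ \<sigma>"

text \<open>For the prime encoding these are the points whose coordinate belonging to a prime
  \<open>p\<close> is at most \<open>(1 / p) ^ \<sigma>\<close> in absolute value. They shrink as
  \<sigma> grows.\<close>

definition polydisc :: "nat \<Rightarrow> 'x set" where
  "polydisc \<sigma> = {x. \<forall>N\<in>S. \<bar>e x N\<bar> \<le> wt \<sigma> N}"

definition val :: "(nat \<Rightarrow> real) \<Rightarrow> 'x \<Rightarrow> real" where
  "val f x = infsum (\<lambda>N. f N * e x N) S"

definition summ :: "nat \<Rightarrow> (nat \<Rightarrow> real) \<Rightarrow> bool" where
  "summ \<sigma> f \<longleftrightarrow> (\<lambda>N. \<bar>f N\<bar> * wt \<sigma> N) summable_on S"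

definition nrm :: "nat \<Rightarrow> (nat \<Rightarrow> real) \<Rightarrow> real" where
  "nrm \<sigma> f = infsum (\<lambda>N. \<bar>f N\<bar> * wt \<sigma> N) S"

lemma wt_pos: "N \<in> S \<Longrightarrow> 0 < wt \<sigma> N"
  using S_pos by (simp add: wt_def)

lemma wt_nonneg [simp]: "0 \<le> wt \<sigma> N"
  by (simp add: wt_def)

lemma wt_mult: "wt \<sigma> (M * N) = wt \<sigma> M * wt \<sigma> N"
  by (simp add: wt_def power_divide power_mult_distrib)

lemma wt_antimono: "N \<in> S \<Longrightarrow> \<sigma> \<le> \<tau> \<Longrightarrow> wt \<tau> N \<le> wt \<sigma> N"
  using S_pos[of N] unfolding wt_def by (intro power_decreasing) auto

lemma polydisc_antimono: "\<sigma> \<le> \<tau> \<Longrightarrow> polydisc \<tau> \<subseteq> polydisc \<sigma>"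
  unfolding polydisc_def using wt_antimono by (blast intro: order.trans)

lemma summ_mono: "summ \<sigma> f \<Longrightarrow> \<sigma> \<le> \<tau> \<Longrightarrow> summ \<tau> f"
  unfolding summ_def
  by (erule summable_on_real_comparison) (auto simp: abs_mult intro!: mult_left_mono wt_antimono)

lemma nrm_antimono:
  assumes "summ \<sigma> f" "\<sigma> \<le> \<tau>"
  shows "nrm \<tau> f \<le> nrm \<sigma> f"
  unfolding nrm_def using assms summ_mono[OF assms]
  by (intro infsum_mono) (auto simp: summ_def intro!: mult_left_mono wt_antimono)

lemma summ_cmult: "summ \<sigma> f \<Longrightarrow> summ \<sigma> (\<lambda>N. c * f N)"
  unfolding summ_def by (drule summable_on_cmult_right[where c="\<bar>c\<bar>"]) (simp add: abs_mult mult.assoc)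

lemma nrm_nonneg: "0 \<le> nrm \<sigma> f"
  unfolding nrm_def by (intro infsum_nonneg) auto

lemma val_cmult: "val (\<lambda>N. c * f N) x = c * val f x"
  unfolding val_def by (simp add: mult.assoc infsum_cmult_right')

lemma val_term_bound: "x \<in> polydisc \<sigma> \<Longrightarrow> N \<in> S \<Longrightarrow> \<bar>f N * e x N\<bar> \<le> \<bar>f N\<bar> * wt \<sigma> N"
  by (auto simp: polydisc_def abs_mult intro!: mult_left_mono)

lemma val_summable: "summ \<sigma> f \<Longrightarrow> x \<in> polydisc \<sigma> \<Longrightarrow> (\<lambda>N. f N * e x N) summable_on S"
  unfolding summ_def by (erule summable_on_real_comparison) (rule val_term_bound)

text \<open>This is where the linear order of the codes matters. A code other than \<open>d\<close>
  with nonzero coefficient is at least \<open>d + 1\<close>. Raising \<sigma> by \<tau> therefore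
  multiplies its weight by at most \<open>(1 / (d + 1)) ^ \<tau>\<close>, while the weight of
  \<open>d\<close> is multiplied by \<open>(1 / d) ^ \<tau>\<close>; the quotient of the two factors
  tends to 0.\<close>

lemma tail_small:
  assumes f: "summ \<sigma>0 f" and d: "d \<in> S" and low: "\<And>M. M \<in> S \<Longrightarrow> M < d \<Longrightarrow> f M = 0"
  shows "\<forall>\<^sub>F \<sigma> in sequentially. infsum (\<lambda>M. \<bar>f M\<bar> * wt \<sigma> M) (S - {d}) \<le> 1/2 * wt \<sigma> d"
proof -
  have d0: "0 < d" using S_pos d by blast
  have "(\<lambda>\<tau>. nrm \<sigma>0 f * (real d / real (d + 1)) ^ \<tau>) \<longlonglongrightarrow> nrm \<sigma>0 f * 0"
    by (intro tendsto_mult tendsto_const LIMSEQ_realpow_zero) auto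
  then have "\<forall>\<^sub>F \<tau> in sequentially. nrm \<sigma>0 f * (real d / real (d + 1)) ^ \<tau> < 1/2 * wt \<sigma>0 d"
    using wt_pos[OF d] by (intro order_tendstoD) auto
  then obtain \<tau>0 where \<tau>0: "\<And>\<tau>. \<tau> \<ge> \<tau>0 \<Longrightarrow> nrm \<sigma>0 f * (real d / real (d + 1)) ^ \<tau> < 1/2 * wt \<sigma>0 d"
    by (auto simp: eventually_sequentially)
  have "infsum (\<lambda>M. \<bar>f M\<bar> * wt \<sigma> M) (S - {d}) \<le> 1/2 * wt \<sigma> d" if \<sigma>: "\<sigma> \<ge> \<sigma>0 + \<tau>0" for \<sigma>
  proof -
    define \<tau> where "\<tau> = \<sigma> - \<sigma>0"
    have \<tau>: "\<sigma> = \<sigma>0 + \<tau>" "\<tau> \<ge> \<tau>0" using \<sigma> by (auto simp: \<tau>_def)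
    have sm: "(\<lambda>M. \<bar>f M\<bar> * wt \<sigma>' M) summable_on S - {d}" if "\<sigma>' \<ge> \<sigma>0" for \<sigma>'
      using summ_mono[OF f that] unfolding summ_def by (rule summable_on_subset_banach) auto
    have "infsum (\<lambda>M. \<bar>f M\<bar> * wt \<sigma> M) (S - {d})
        \<le> infsum (\<lambda>M. \<bar>f M\<bar> * wt \<sigma>0 M * (1 / real (d + 1)) ^ \<tau>) (S - {d})"
    proof (rule infsum_mono)
      show "(\<lambda>M. \<bar>f M\<bar> * wt \<sigma> M) summable_on S - {d}" using sm \<tau> by simp
      show "(\<lambda>M. \<bar>f M\<bar> * wt \<sigma>0 M * (1 / real (d + 1)) ^ \<tau>) summable_on S - {d}"
        by (intro summable_on_cmult_left sm) simp
      fix M assume M: "M \<in> S - {d}"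
      show "\<bar>f M\<bar> * wt \<sigma> M \<le> \<bar>f M\<bar> * wt \<sigma>0 M * (1 / real (d + 1)) ^ \<tau>"
      proof (cases "M < d")
        case True
        then show ?thesis using low M by simp
      next
        case False
        with M have "d + 1 \<le> M" by auto
        then have "(1 / real M) ^ \<tau> \<le> (1 / real (d + 1)) ^ \<tau>"
          by (intro power_mono divide_left_mono) auto
        then have "\<bar>f M\<bar> * wt \<sigma>0 M * (1 / real M) ^ \<tau> \<le> \<bar>f M\<bar> * wt \<sigma>0 M * (1 / real (d + 1)) ^ \<tau>"
          by (intro mult_left_mono) auto
        then show ?thesis by (simp add: wt_def \<tau> power_add mult.assoc)
      qed
    qed
    also have "\<dots> = infsum (\<lambda>M. \<bar>f M\<bar> * wt \<sigma>0 M) (S - {d}) * (1 / real (d + 1)) ^ \<tau>"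
      by (rule infsum_cmult_left')
    also have "\<dots> \<le> nrm \<sigma>0 f * (1 / real (d + 1)) ^ \<tau>"
      unfolding nrm_def using f sm[of \<sigma>0]
      by (intro mult_right_mono infsum_mono_neutral) (auto simp: summ_def)
    also have "\<dots> = nrm \<sigma>0 f * (real d / real (d + 1)) ^ \<tau> * (1 / real d) ^ \<tau>"
      using d0 by (simp add: power_divide)
    also have "\<dots> \<le> 1/2 * wt \<sigma>0 d * (1 / real d) ^ \<tau>"
      using \<tau>0[OF \<tau>(2)] by (intro mult_right_mono) auto
    also have "\<dots> = 1/2 * wt \<sigma> d"
      by (simp add: \<tau> wt_def power_add)
    finally show ?thesis .
  qed
  then show ?thesis unfolding eventually_sequentially by blast
qed

text \<open>The products \<open>h N * G N M\<close>, weighted by \<open>wt \<sigma> M\<close>, are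
  absolutely summable over all pairs, because row \<open>N\<close> contributes at most
  \<open>c\<close> times the weighted size of \<open>h N\<close>. Hence the order of summation may
  be exchanged, both for the norm and for the value at a point.\<close>

lemma val_infsum_combination:
  assumes f: "summ \<sigma> f"
    and h: "(\<lambda>N. \<bar>h N\<bar> * wt \<sigma> N) summable_on D"
    and G: "\<And>N. N \<in> D \<Longrightarrow> summ \<sigma> (G N)" "\<And>N. N \<in> D \<Longrightarrow> nrm \<sigma> (G N) \<le> c * wt \<sigma> N"
  defines "r \<equiv> \<lambda>M. f M - infsum (\<lambda>N. h N * G N M) D"
  shows "summ \<sigma> r"
    and "x \<in> polydisc \<sigma> \<Longrightarrow> val r x = val f x - infsum (\<lambda>N. h N * val (G N) x) D"
proof -
  let ?u = "\<lambda>p. h (fst p) * G (fst p) (snd p) * wt \<sigma> (snd p)"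
  have u_row: "infsum (\<lambda>M. norm (?u (N, M))) S = \<bar>h N\<bar> * nrm \<sigma> (G N)" for N
    unfolding nrm_def by (simp add: abs_mult mult.assoc infsum_cmult_right')
  have "(\<lambda>p. norm (?u p)) summable_on D \<times> S"
    unfolding Infinite_Sum.abs_summable_on_Sigma_iff
  proof (intro conjI ballI)
    fix N assume "N \<in> D"
    then show "(\<lambda>M. norm (?u (N, M))) summable_on S"
      using G(1)[of N] by (auto simp: abs_mult mult.assoc summ_def intro: summable_on_cmult_right)
  next
    have "(\<lambda>N. \<bar>h N\<bar> * nrm \<sigma> (G N)) summable_on D"
    proof (rule summable_on_real_comparison[OF summable_on_cmult_right[OF h, of c]])
      fix N assume N: "N \<in> D"
      show "\<bar>\<bar>h N\<bar> * nrm \<sigma> (G N)\<bar> \<le> c * (\<bar>h N\<bar> * wt \<sigma> N)"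
        using mult_left_mono[OF G(2)[OF N], of "\<bar>h N\<bar>"] nrm_nonneg[of \<sigma> "G N"]
        by (simp add: abs_mult algebra_simps)
    qed
    then show "(\<lambda>N. norm (infsum (\<lambda>M. norm (?u (N, M))) S)) summable_on D"
      unfolding u_row by (simp add: nrm_nonneg abs_mult)
  qed
  then have u: "(\<lambda>p. \<bar>?u p\<bar>) summable_on D \<times> S" by simp
  have sw: "(\<lambda>(M, N). \<bar>h N * G N M * wt \<sigma> M\<bar>) summable_on S \<times> D"
    using u by (subst summable_on_swap) (simp add: case_prod_unfold)
  have "(\<lambda>M. infsum (\<lambda>N. \<bar>h N * G N M * wt \<sigma> M\<bar>) D) summable_on S"
    using summable_on_Sigma_banach[OF sw] .
  then have "(\<lambda>M. \<bar>f M\<bar> * wt \<sigma> M + infsum (\<lambda>N. \<bar>h N * G N M * wt \<sigma> M\<bar>) D) summable_on S"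
    using f by (intro summable_on_add) (auto simp: summ_def)
  then show r: "summ \<sigma> r" unfolding summ_def
  proof (rule summable_on_real_comparison)
    fix M assume M: "M \<in> S"
    have "\<bar>infsum (\<lambda>N. h N * G N M) D\<bar> * wt \<sigma> M = \<bar>infsum (\<lambda>N. h N * G N M * wt \<sigma> M) D\<bar>"
      by (simp add: infsum_cmult_left' abs_mult)
    also have "\<dots> \<le> infsum (\<lambda>N. \<bar>h N * G N M * wt \<sigma> M\<bar>) D"
      using summable_on_SigmaD1[OF sw M] by (intro abs_infsum_le) auto
    finally have 1: "\<bar>infsum (\<lambda>N. h N * G N M) D\<bar> * wt \<sigma> M \<le> infsum (\<lambda>N. \<bar>h N * G N M * wt \<sigma> M\<bar>) D" .
    have "\<bar>r M\<bar> \<le> \<bar>f M\<bar> + \<bar>infsum (\<lambda>N. h N * G N M) D\<bar>" unfolding r_def by linarith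
    then have "\<bar>r M\<bar> * wt \<sigma> M \<le> (\<bar>f M\<bar> + \<bar>infsum (\<lambda>N. h N * G N M) D\<bar>) * wt \<sigma> M"
      by (rule mult_right_mono) simp
    then show "\<bar>\<bar>r M\<bar> * wt \<sigma> M\<bar> \<le> \<bar>f M\<bar> * wt \<sigma> M + infsum (\<lambda>N. \<bar>h N * G N M * wt \<sigma> M\<bar>) D"
      using 1 by (simp add: distrib_right abs_mult)
  qed
  assume x: "x \<in> polydisc \<sigma>"
  have v: "(\<lambda>(N, M). h N * G N M * e x M) summable_on D \<times> S"
    by (rule summable_on_real_comparison[OF u])
       (use x in \<open>auto simp: abs_mult polydisc_def intro!: mult_left_mono\<close>)
  have row: "infsum (\<lambda>M. h N * G N M * e x M) S = h N * val (G N) x" for N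
    unfolding val_def by (simp add: mult.assoc infsum_cmult_right')
  have v': "(\<lambda>(M, N). h N * G N M * e x M) summable_on S \<times> D"
    using v by (subst summable_on_swap) (simp add: case_prod_unfold)
  have "infsum (\<lambda>N. h N * val (G N) x) D = infsum (\<lambda>M. infsum (\<lambda>N. h N * G N M * e x M) D) S"
    using infsum_swap_banach[OF v] by (simp add: row)
  also have "\<dots> = infsum (\<lambda>M. infsum (\<lambda>N. h N * G N M) D * e x M) S"
    by (simp add: infsum_cmult_left')
  finally have "infsum (\<lambda>N. h N * val (G N) x) D = \<dots>" .
  moreover have "(\<lambda>M. infsum (\<lambda>N. h N * G N M) D * e x M) summable_on S"
    using summable_on_Sigma_banach[OF v'] by (simp add: infsum_cmult_left')
  ultimately have "infsum (\<lambda>M. r M * e x M + infsum (\<lambda>N. h N * G N M) D * e x M) S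
      = val r x + infsum (\<lambda>N. h N * val (G N) x) D"
    using val_summable[OF r x] unfolding val_def by (simp add: infsum_add)
  then show "val r x = val f x - infsum (\<lambda>N. h N * val (G N) x) D"
    unfolding val_def r_def by (simp add: algebra_simps)
qed

text \<open>\<open>shift q f\<close> is the product of the series \<open>f\<close> with the monomial of code \<open>q\<close>.\<close>

definition shift :: "nat \<Rightarrow> (nat \<Rightarrow> real) \<Rightarrow> nat \<Rightarrow> real" where
  "shift q f M = (if M \<in> (*) q ` S then f (M div q) else 0)"

lemma shift_mult: "q \<in> S \<Longrightarrow> L \<in> S \<Longrightarrow> shift q f (q * L) = f L"
  using S_pos[of q] by (simp add: shift_def)

lemma has_sum_shift:
  assumes q: "q \<in> S" and A: "A \<subseteq> S" and h: "\<And>M. M \<notin> (*) q ` S \<Longrightarrow> h M = 0"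
  shows "(h has_sum s) (S - (*) q ` A) \<longleftrightarrow> ((\<lambda>L. h (q * L)) has_sum s) (S - A)"
proof (rule has_sum_reindex_neutral)
  show "inj_on ((*) q) (S - A)" using S_pos[OF q] by (auto intro: inj_onI)
  show "(*) q ` (S - A) \<subseteq> S - (*) q ` A" using S_mult[OF q] S_pos[OF q] by auto
qed (use h in auto)

text \<open>Weights are multiplicative, so a monomial factor scales every term by
  \<open>wt \<sigma> q\<close>. With \<open>A\<close> empty this concerns the whole norm; with
  \<open>A\<close> a single leading code it carries the tail estimate of a series over to its
  monomial multiples.\<close>

lemma shift_norm:
  assumes q: "q \<in> S" and f: "summ \<sigma> f" and A: "A \<subseteq> S"
  shows "summ \<sigma> (shift q f)"
    and "infsum (\<lambda>M. \<bar>shift q f M\<bar> * wt \<sigma> M) (S - (*) q ` A)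
       = wt \<sigma> q * infsum (\<lambda>L. \<bar>f L\<bar> * wt \<sigma> L) (S - A)"
proof -
  have "((\<lambda>M. \<bar>shift q f M\<bar> * wt \<sigma> M) has_sum (wt \<sigma> q * infsum (\<lambda>L. \<bar>f L\<bar> * wt \<sigma> L) (S - A))) (S - (*) q ` A)"
    if A: "A \<subseteq> S" for A
  proof (subst has_sum_shift[OF q A])
    have "((\<lambda>L. wt \<sigma> q * (\<bar>f L\<bar> * wt \<sigma> L)) has_sum (wt \<sigma> q * infsum (\<lambda>L. \<bar>f L\<bar> * wt \<sigma> L) (S - A))) (S - A)"
      using f unfolding summ_def
      by (intro has_sum_cmult_right has_sum_infsum) (rule summable_on_subset_banach, auto)
    then show "((\<lambda>L. \<bar>shift q f (q * L)\<bar> * wt \<sigma> (q * L)) has_sum (wt \<sigma> q * infsum (\<lambda>L. \<bar>f L\<bar> * wt \<sigma> L) (S - A))) (S - A)"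
      by (rule has_sum_cong[THEN iffD1, rotated]) (simp add: shift_mult[OF q] wt_mult)
  qed (simp add: shift_def)
  from this[OF A] this[of "{}"]
  show "summ \<sigma> (shift q f)"
    and "infsum (\<lambda>M. \<bar>shift q f M\<bar> * wt \<sigma> M) (S - (*) q ` A)
       = wt \<sigma> q * infsum (\<lambda>L. \<bar>f L\<bar> * wt \<sigma> L) (S - A)"
    unfolding summ_def by (auto intro: infsumI has_sum_imp_summable)
qed

lemma val_shift:
  assumes q: "q \<in> S" and f: "summ \<sigma> f" and x: "x \<in> polydisc \<sigma>"
  shows "val (shift q f) x = e x q * val f x"
  unfolding val_def
proof (rule infsumI)
  have "((\<lambda>L. e x q * (f L * e x L)) has_sum (e x q * infsum (\<lambda>L. f L * e x L) S)) S"
    using val_summable[OF f x] by (intro has_sum_cmult_right has_sum_infsum)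
  then have "((\<lambda>L. shift q f (q * L) * e x (q * L)) has_sum (e x q * infsum (\<lambda>L. f L * e x L) S)) S"
    by (rule has_sum_cong[THEN iffD1, rotated]) (simp add: shift_mult[OF q] e_mult[OF q])
  then show "((\<lambda>M. shift q f M * e x M) has_sum (e x q * infsum (\<lambda>L. f L * e x L) S)) S"
    using has_sum_shift[OF q, of "{}" "\<lambda>M. shift q f M * e x M"] by (simp add: shift_def)
qed

text \<open>The set \<open>J\<close> of the proof takes the place of an ideal: membership records
  only a bound, whose \<sigma>, \<open>C\<close> and \<open>k\<close> may depend on the series. The
  final \<sigma> and \<open>k\<close> are fixed by \<sigma>\<open>0\<close> and finitely many
  divisors before \<open>j\<close> enters, and division costs only a factor 2 in the norm, so one
  constant times \<open>K j\<close> serves all \<open>j\<close>.\<close>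

theorem dominated_by_finitely_many:
  fixes b :: "nat \<Rightarrow> nat \<Rightarrow> real"
  assumes b: "\<And>j. summ \<sigma>0 (b j)" and b_nrm: "\<And>j. nrm \<sigma>0 (b j) \<le> K j"
  obtains \<sigma> C k where "0 \<le> C"
    and "\<And>x j. x \<in> polydisc \<sigma> \<Longrightarrow> \<bar>val (b j) x\<bar> \<le> C * K j * (\<Sum>l\<le>k. \<bar>val (b l) x\<bar>)"
proof -
  define B where "B k x = (\<Sum>l\<le>k. \<bar>val (b l) x\<bar>)" for k :: nat and x
  have B_nonneg: "0 \<le> B k x" for k x by (simp add: B_def sum_nonneg)
  have B_mono: "B k x \<le> B k' x" if "k \<le> k'" for k k' x
    unfolding B_def using that by (intro sum_mono2) auto
  have B_ge: "\<bar>val (b l) x\<bar> \<le> B k x" if "l \<le> k" for l k x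
    unfolding B_def using that by (intro member_le_sum) auto
  define J where "J = {f. \<exists>\<sigma> C k. summ \<sigma> f \<and> 0 \<le> C \<and> (\<forall>x\<in>polydisc \<sigma>. \<bar>val f x\<bar> \<le> C * B k x)}"
  define monic where "monic f N \<longleftrightarrow> f N = 1 \<and> (\<forall>M\<in>S. M < N \<longrightarrow> f M = 0)" for f :: "nat \<Rightarrow> real" and N
  define Lead where "Lead = {N\<in>S. \<exists>f\<in>J. monic f N}"
  \<comment> \<open>The leading term is the one of least code. Dividing by its coefficient makes the
    series monic and only changes the constant in the bound.\<close>
  have lead_exists: "\<exists>N\<in>Lead. f N \<noteq> 0" if f: "f \<in> J" and ne: "M \<in> S" "f M \<noteq> 0" for f M
  proof -
    define N where "N = (LEAST N. N \<in> S \<and> f N \<noteq> 0)"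
    have N: "N \<in> S" "f N \<noteq> 0" using LeastI[of "\<lambda>N. N \<in> S \<and> f N \<noteq> 0" M] ne by (auto simp: N_def)
    have min: "f M = 0" if "M \<in> S" "M < N" for M
      using not_less_Least that unfolding N_def by blast
    obtain \<sigma> C k where "summ \<sigma> f" "0 \<le> C" and le: "\<And>x. x \<in> polydisc \<sigma> \<Longrightarrow> \<bar>val f x\<bar> \<le> C * B k x"
      using f by (auto simp: J_def)
    then have "summ \<sigma> (\<lambda>M. 1 / f N * f M)" "0 \<le> \<bar>1 / f N\<bar> * C" using summ_cmult[of \<sigma> f "1 / f N"] by auto
    moreover have "\<bar>val (\<lambda>M. 1 / f N * f M) x\<bar> \<le> \<bar>1 / f N\<bar> * C * B k x" if "x \<in> polydisc \<sigma>" for x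
      unfolding val_cmult abs_mult mult.assoc using le[OF that] by (intro mult_left_mono) auto
    ultimately have "(\<lambda>M. 1 / f N * f M) \<in> J" unfolding J_def by blast
    moreover have "monic (\<lambda>M. 1 / f N * f M) N" using N min by (auto simp: monic_def)
    ultimately show ?thesis using N by (auto simp: Lead_def)
  qed
  obtain \<Phi> where \<Phi>: "finite \<Phi>" "\<Phi> \<subseteq> Lead" and \<Phi>_div: "\<And>a. a \<in> Lead \<Longrightarrow> \<exists>d\<in>\<Phi>. \<exists>q\<in>S. a = q * d"
    using dickson[of Lead] by (auto simp: Lead_def)
  have \<Phi>S: "d \<in> S" if "d \<in> \<Phi>" for d using that \<Phi> by (auto simp: Lead_def)
  have "\<forall>d\<in>\<Phi>. \<exists>f. f \<in> J \<and> monic f d" using \<Phi> by (auto simp: Lead_def)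
  then obtain \<phi> where \<phi>: "\<And>d. d \<in> \<Phi> \<Longrightarrow> \<phi> d \<in> J \<and> monic (\<phi> d) d" by metis
  then have "\<forall>d\<in>\<Phi>. \<exists>\<sigma> C k. summ \<sigma> (\<phi> d) \<and> 0 \<le> C \<and> (\<forall>x\<in>polydisc \<sigma>. \<bar>val (\<phi> d) x\<bar> \<le> C * B k x)"
    by (auto simp: J_def)
  then obtain s C kk where s: "\<And>d. d \<in> \<Phi> \<Longrightarrow> summ (s d) (\<phi> d)" and C: "\<And>d. d \<in> \<Phi> \<Longrightarrow> 0 \<le> C d"
    and Ck: "\<And>d x. d \<in> \<Phi> \<Longrightarrow> x \<in> polydisc (s d) \<Longrightarrow> \<bar>val (\<phi> d) x\<bar> \<le> C d * B (kk d) x"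
    by metis
  \<comment> \<open>Each condition holds for all large \<sigma> and there are finitely many
    divisors, so a common \<sigma> exists.\<close>
  have "\<forall>\<^sub>F \<sigma> in sequentially. \<sigma> \<ge> \<sigma>0 \<and> (\<forall>d\<in>\<Phi>. \<sigma> \<ge> s d \<and>
      infsum (\<lambda>M. \<bar>\<phi> d M\<bar> * wt \<sigma> M) (S - {d}) \<le> 1/2 * wt \<sigma> d)"
    using \<Phi>(1) \<phi> \<Phi>S by (intro eventually_conj eventually_ball_finite ballI tail_small[OF s]
        eventually_ge_at_top) (auto simp: monic_def)
  then obtain \<sigma> where \<sigma>: "\<sigma> \<ge> \<sigma>0" and \<sigma>s: "\<And>d. d \<in> \<Phi> \<Longrightarrow> \<sigma> \<ge> s d"
    and tail: "\<And>d. d \<in> \<Phi> \<Longrightarrow> infsum (\<lambda>M. \<bar>\<phi> d M\<bar> * wt \<sigma> M) (S - {d}) \<le> 1/2 * wt \<sigma> d"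
    by (auto simp: eventually_sequentially)
  have summ_\<phi>: "summ \<sigma> (\<phi> d)" if "d \<in> \<Phi>" for d
    using summ_mono[OF s \<sigma>s] that by blast
  \<comment> \<open>The codes at which the remainder is made to vanish. All of \<open>Lead\<close>
    lies among them.\<close>
  define D where "D = {N\<in>S. \<exists>d\<in>\<Phi>. \<exists>q\<in>S. N = q * d}"
  have DS: "D \<subseteq> S" by (auto simp: D_def)
  have "\<forall>N\<in>D. \<exists>d q. d \<in> \<Phi> \<and> q \<in> S \<and> N = q * d" by (auto simp: D_def)
  then obtain dd qq where dd: "\<And>N. N \<in> D \<Longrightarrow> dd N \<in> \<Phi>" and qq: "\<And>N. N \<in> D \<Longrightarrow> qq N \<in> S"
    and Neq: "\<And>N. N \<in> D \<Longrightarrow> N = qq N * dd N" by metis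
  \<comment> \<open>A monomial multiple of a divisor, with leading code \<open>N\<close> and the
    same relative tail as the divisor. These are the rows of the triangular system.\<close>
  define G where "G N = shift (qq N) (\<phi> (dd N))" for N
  have G_summ: "summ \<sigma> (G N)" if "N \<in> D" for N
    unfolding G_def using shift_norm(1)[OF qq summ_\<phi>, of N "dd N" "{}"] dd that by simp
  have G_diag: "G N N = 1" if "N \<in> D" for N
    using shift_mult[OF qq \<Phi>S[OF dd], OF that that] Neq[OF that] \<phi>[OF dd[OF that]]
    by (simp add: G_def monic_def)
  have G_low: "G N M = 0" if "N \<in> D" "M \<in> S" "M < N" for N M
  proof (cases "M \<in> (*) (qq N) ` S")
    case True
    then obtain L where L: "L \<in> S" "M = qq N * L" by auto
    then have "L < dd N" using Neq[OF that(1)] that(3) by (metis nat_mult_less_cancel1 S_pos qq that(1))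
    then show ?thesis
      using L \<phi>[OF dd[OF that(1)]] shift_mult[OF qq[OF that(1)] L(1)] by (simp add: G_def monic_def)
  qed (simp add: G_def shift_def)
  have G_tail: "infsum (\<lambda>M. \<bar>G N M\<bar> * wt \<sigma> M) (S - {N}) \<le> 1/2 * wt \<sigma> N" if N: "N \<in> D" for N
  proof -
    have "infsum (\<lambda>M. \<bar>G N M\<bar> * wt \<sigma> M) (S - {N})
        = wt \<sigma> (qq N) * infsum (\<lambda>L. \<bar>\<phi> (dd N) L\<bar> * wt \<sigma> L) (S - {dd N})"
      using shift_norm(2)[OF qq[OF N] summ_\<phi>[OF dd[OF N]], of "{dd N}"] Neq[OF N] \<Phi>S[OF dd[OF N]]
      by (simp add: G_def)
    also have "\<dots> \<le> wt \<sigma> (qq N) * (1/2 * wt \<sigma> (dd N))"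
      using tail[OF dd[OF N]] by (intro mult_left_mono) auto
    also have "\<dots> = 1/2 * wt \<sigma> N"
      using wt_mult[of \<sigma> "qq N" "dd N"] Neq[OF N] by simp
    finally show ?thesis .
  qed
  have G_nrm: "nrm \<sigma> (G N) \<le> 3/2 * wt \<sigma> N" if N: "N \<in> D" for N
  proof -
    have NS: "N \<in> S" using N DS by auto
    have "nrm \<sigma> (G N) = \<bar>G N N\<bar> * wt \<sigma> N + infsum (\<lambda>M. \<bar>G N M\<bar> * wt \<sigma> M) (S - {N})"
      unfolding nrm_def using G_summ[OF N] NS infsum_insert[of "\<lambda>M. \<bar>G N M\<bar> * wt \<sigma> M" "S - {N}" N]
      by (simp add: summ_def insert_absorb summable_on_subset_banach)
    then show ?thesis using G_diag[OF N] G_tail[OF N] by simp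
  qed
  define k where "k = (\<Sum>d\<in>\<Phi>. kk d)"
  \<comment> \<open>The factor \<open>real d ^ \<sigma>\<close> converts the weight of the cofactor
    \<open>q\<close> into the weight of \<open>N = q * d\<close>. The sum serves as a common upper
    bound over all divisors.\<close>
  define C' where "C' = (\<Sum>d\<in>\<Phi>. real d ^ \<sigma> * C d)"
  have C'_nonneg: "0 \<le> C'" unfolding C'_def using C by (intro sum_nonneg) auto
  have G_val: "\<bar>val (G N) x\<bar> \<le> wt \<sigma> N * (C' * B k x)" if N: "N \<in> D" and x: "x \<in> polydisc \<sigma>" for N x
  proof -
    let ?d = "dd N" and ?q = "qq N"
    have d0: "0 < ?d" using S_pos \<Phi>S dd N by blast
    have xs: "x \<in> polydisc (s ?d)" using polydisc_antimono[OF \<sigma>s[OF dd[OF N]]] x by blast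
    have "\<bar>val (G N) x\<bar> = \<bar>e x ?q\<bar> * \<bar>val (\<phi> ?d) x\<bar>"
      unfolding G_def val_shift[OF qq[OF N] summ_\<phi>[OF dd[OF N]] x] by (rule abs_mult)
    also have "\<dots> \<le> wt \<sigma> ?q * (C ?d * B k x)"
    proof (rule mult_mono)
      show "\<bar>e x ?q\<bar> \<le> wt \<sigma> ?q" using x qq[OF N] by (simp add: polydisc_def)
      have "kk ?d \<le> k" unfolding k_def using dd[OF N] \<Phi>(1) by (intro member_le_sum) auto
      then show "\<bar>val (\<phi> ?d) x\<bar> \<le> C ?d * B k x"
        using Ck[OF dd[OF N] xs] mult_left_mono[OF B_mono C[OF dd[OF N]]] by (blast intro: order.trans)
    qed auto
    also have "\<dots> = wt \<sigma> N * (real ?d ^ \<sigma> * C ?d * B k x)"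
      using wt_mult[of \<sigma> ?q ?d] Neq[OF N] d0 by (simp add: wt_def[of _ ?d] power_divide)
    also have "\<dots> \<le> wt \<sigma> N * (C' * B k x)"
    proof (intro mult_left_mono mult_right_mono B_nonneg)
      show "real ?d ^ \<sigma> * C ?d \<le> C'"
        unfolding C'_def using dd[OF N] \<Phi>(1) C by (intro member_le_sum) auto
    qed auto
    finally show ?thesis .
  qed
  have main: "\<bar>val (b j) x\<bar> \<le> 2 * C' * K j * B k x" if x: "x \<in> polydisc \<sigma>" for x j
  proof -
    have f: "summ \<sigma> (b j)" using summ_mono[OF b \<sigma>] .
    obtain h where h: "(\<lambda>N. \<bar>h N\<bar> * wt \<sigma> N) summable_on D"
      and h_nrm: "infsum (\<lambda>N. \<bar>h N\<bar> * wt \<sigma> N) D \<le> 2 * infsum (\<lambda>M. \<bar>b j M\<bar> * wt \<sigma> M) S"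
      and h_eq: "\<And>M. M \<in> D \<Longrightarrow> (\<Sum>N\<in>{N\<in>D. N \<le> M}. h N * G N M) = b j M"
      by (rule triangular_reduction[OF DS wt_pos f[unfolded summ_def] G_diag
            G_summ[unfolded summ_def] G_tail]) blast+
    define r where "r M = b j M - infsum (\<lambda>N. h N * G N M) D" for M
    have r0D: "r M = 0" if M: "M \<in> D" for M
    proof -
      \<comment> \<open>Rows with leading code above \<open>M\<close> have no entry at
        \<open>M\<close>, so the infinite combination reduces to the finite system solved by
        \<open>h\<close>.\<close>
      have "infsum (\<lambda>N. h N * G N M) D = infsum (\<lambda>N. h N * G N M) {N\<in>D. N \<le> M}"
        using G_low M DS by (intro infsum_cong_neutral) (auto simp: not_le)
      also have "\<dots> = b j M" using h_eq[OF M] by simp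
      finally show ?thesis by (simp add: r_def)
    qed
    have r_summ: "summ \<sigma> r"
      and r_val: "\<And>y. y \<in> polydisc \<sigma> \<Longrightarrow> val r y = val (b j) y - infsum (\<lambda>N. h N * val (G N) y) D"
      using val_infsum_combination[OF f h G_summ G_nrm, folded r_def] by simp_all
    have tail_le: "\<bar>infsum (\<lambda>N. h N * val (G N) y) D\<bar> \<le> 2 * C' * K j * B k y" if y: "y \<in> polydisc \<sigma>" for y
    proof -
      have "\<bar>infsum (\<lambda>N. h N * val (G N) y) D\<bar> \<le> infsum (\<lambda>N. \<bar>h N\<bar> * wt \<sigma> N * (C' * B k y)) D"
      proof (rule abs_infsum_le)
        show "(\<lambda>N. \<bar>h N\<bar> * wt \<sigma> N * (C' * B k y)) summable_on D"
          by (rule summable_on_cmult_left[OF h])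
      qed (use G_val[OF _ y] in \<open>auto simp: abs_mult mult.assoc intro: mult_left_mono\<close>)
      also have "\<dots> = infsum (\<lambda>N. \<bar>h N\<bar> * wt \<sigma> N) D * (C' * B k y)"
        by (rule infsum_cmult_left')
      also have "\<dots> \<le> (2 * K j) * (C' * B k y)"
      proof (rule mult_right_mono)
        have "infsum (\<lambda>M. \<bar>b j M\<bar> * wt \<sigma> M) S \<le> K j"
          using nrm_antimono[OF b \<sigma>] b_nrm unfolding nrm_def by (rule order.trans)
        then show "infsum (\<lambda>N. \<bar>h N\<bar> * wt \<sigma> N) D \<le> 2 * K j" using h_nrm by linarith
      qed (simp add: C'_nonneg B_nonneg)
      finally show ?thesis by (simp add: algebra_simps)
    qed
    have Kj: "0 \<le> K j" using nrm_nonneg b_nrm by (rule order.trans)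
    \<comment> \<open>The bound with \<open>max j k\<close> still depends on \<open>j\<close>. It
      serves only to place \<open>r\<close> in \<open>J\<close>, which forces \<open>r\<close> to
      vanish; then \<open>tail_le\<close> bounds \<open>b j\<close> with a \<open>k\<close>
      independent of \<open>j\<close>.\<close>
    have "r \<in> J"
    proof -
      have "\<bar>val r y\<bar> \<le> (1 + 2 * C' * K j) * B (max j k) y" if y: "y \<in> polydisc \<sigma>" for y
      proof -
        have "\<bar>val r y\<bar> \<le> \<bar>val (b j) y\<bar> + \<bar>infsum (\<lambda>N. h N * val (G N) y) D\<bar>"
          unfolding r_val[OF y] by linarith
        also have "\<dots> \<le> B (max j k) y + 2 * C' * K j * B (max j k) y"
          by (intro add_mono B_ge order.trans[OF tail_le[OF y]] mult_left_mono B_mono) (auto simp: C'_nonneg Kj)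
        finally show ?thesis by (simp add: algebra_simps)
      qed
      moreover have "0 \<le> 1 + 2 * C' * K j" using C'_nonneg Kj by simp
      ultimately show ?thesis using r_summ unfolding J_def by blast
    qed
    have "r M = 0" if M: "M \<in> S" for M
    proof (rule ccontr)
      assume "r M \<noteq> 0"
      then obtain N where "N \<in> Lead" "r N \<noteq> 0" using lead_exists[OF \<open>r \<in> J\<close> M] by blast
      moreover from this have "N \<in> D" using \<Phi>_div[of N] by (auto simp: D_def Lead_def)
      ultimately show False using r0D by blast
    qed
    then have "val r x = 0" unfolding val_def by (intro infsum_0) auto
    then show ?thesis using r_val[OF x] tail_le[OF x] by simp
  qed
  show thesis
    by (rule that[of "2 * C'" \<sigma> k]) (use main C'_nonneg in \<open>auto simp: B_def\<close>)
qed

end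

subsection \<open>Multivariate power series and their zero sets\<close>

definition mono_at :: "'i set \<Rightarrow> ('i \<Rightarrow> real) \<Rightarrow> ('i \<Rightarrow> nat) \<Rightarrow> real" where
  "mono_at I x \<alpha> = (\<Prod>i\<in>I. x i ^ \<alpha> i)"

definition pser :: "'i set \<Rightarrow> (('i \<Rightarrow> nat) \<Rightarrow> real) \<Rightarrow> ('i \<Rightarrow> real) \<Rightarrow> real" where
  "pser I c x = infsum (\<lambda>\<alpha>. c \<alpha> * mono_at I x \<alpha>) (I \<rightarrow>\<^sub>E UNIV)"

definition pnorm_summable :: "'i set \<Rightarrow> real \<Rightarrow> (('i \<Rightarrow> nat) \<Rightarrow> real) \<Rightarrow> bool" where
  "pnorm_summable I \<rho> c \<longleftrightarrow> (\<lambda>\<alpha>. \<bar>c \<alpha>\<bar> * mono_at I (\<lambda>_. \<rho>) \<alpha>) summable_on (I \<rightarrow>\<^sub>E UNIV)"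

definition pnorm :: "'i set \<Rightarrow> real \<Rightarrow> (('i \<Rightarrow> nat) \<Rightarrow> real) \<Rightarrow> real" where
  "pnorm I \<rho> c = infsum (\<lambda>\<alpha>. \<bar>c \<alpha>\<bar> * mono_at I (\<lambda>_. \<rho>) \<alpha>) (I \<rightarrow>\<^sub>E UNIV)"

text \<open>The coefficients of the series that multiplies the \<open>j\<close>-th power of variable
  \<open>i\<close>. For the last variable it is the b_j of the overview.\<close>

definition slice :: "'i \<Rightarrow> (('i \<Rightarrow> nat) \<Rightarrow> real) \<Rightarrow> nat \<Rightarrow> ('i \<Rightarrow> nat) \<Rightarrow> real" where
  "slice i c j \<alpha> = c (\<alpha>(i := j))"

lemma abs_mono_at_le:
  assumes "\<And>i. i \<in> I \<Longrightarrow> \<bar>x i\<bar> \<le> \<rho>"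
  shows "\<bar>mono_at I x \<alpha>\<bar> \<le> mono_at I (\<lambda>_. \<rho>) \<alpha>"
  unfolding mono_at_def abs_prod
  using assms by (intro prod_mono) (auto simp: power_abs intro!: power_mono)

lemma mono_at_insert:
  assumes "finite I" "i \<notin> I"
  shows "mono_at (insert i I) x (\<alpha>(i := j)) = x i ^ j * mono_at I x \<alpha>"
  using assms unfolding mono_at_def by (simp, intro disjI2 prod.cong) auto

lemma mono_at_nonneg: "0 \<le> \<rho> \<Longrightarrow> 0 \<le> mono_at I (\<lambda>_. \<rho>) \<alpha>"
  unfolding mono_at_def by (intro prod_nonneg) auto

lemma pnorm_nonneg: "0 \<le> \<rho> \<Longrightarrow> 0 \<le> pnorm I \<rho> c"
  unfolding pnorm_def by (intro infsum_nonneg) (simp add: mono_at_nonneg)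

lemma pser_term_le:
  assumes "\<And>i. i \<in> I \<Longrightarrow> \<bar>x i\<bar> \<le> \<rho>"
  shows "\<bar>c \<alpha> * mono_at I x \<alpha>\<bar> \<le> \<bar>c \<alpha>\<bar> * mono_at I (\<lambda>_. \<rho>) \<alpha>"
  unfolding abs_mult by (intro mult_left_mono abs_mono_at_le assms) auto

lemma pser_summable:
  assumes "pnorm_summable I \<rho> c" "\<And>i. i \<in> I \<Longrightarrow> \<bar>x i\<bar> \<le> \<rho>"
  shows "(\<lambda>\<alpha>. c \<alpha> * mono_at I x \<alpha>) summable_on (I \<rightarrow>\<^sub>E UNIV)"
  using assms(1) unfolding pnorm_summable_def
  by (rule summable_on_real_comparison) (rule pser_term_le[OF assms(2)])

lemma abs_pser_le:
  assumes "pnorm_summable I \<rho> c" "\<And>i. i \<in> I \<Longrightarrow> \<bar>x i\<bar> \<le> \<rho>"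
  shows "\<bar>pser I c x\<bar> \<le> pnorm I \<rho> c"
  unfolding pser_def pnorm_def using assms(1) unfolding pnorm_summable_def
  by (rule abs_infsum_le) (rule pser_term_le[OF assms(2)])

lemma pser_cong:
  assumes "\<And>i. i \<in> I \<Longrightarrow> x i = y i"
  shows "pser I c x = pser I c y"
  unfolding pser_def mono_at_def using assms by (intro infsum_cong) simp

lemma bij_betw_PiE_insert:
  assumes "i \<notin> I"
  shows "bij_betw (\<lambda>(j, \<alpha>). \<alpha>(i := j)) (UNIV \<times> (I \<rightarrow>\<^sub>E UNIV)) (insert i I \<rightarrow>\<^sub>E UNIV)"
  using inj_combinator[OF assms, of "\<lambda>_. UNIV"] unfolding bij_betw_def PiE_insert_eq
  by (auto simp: case_prod_unfold inj_on_def)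

section \<open>Expansion of a series in powers of one distinguished variable\<close>

context
  fixes I :: "'i set" and i :: 'i and \<rho> :: real and c :: "('i \<Rightarrow> nat) \<Rightarrow> real"
  assumes I: "finite I" "i \<notin> I" and \<rho>: "0 < \<rho>" and c: "pnorm_summable (insert i I) \<rho> c"
begin

lemma pnorm_slice_summable2:
  "(\<lambda>(j, \<alpha>). \<rho> ^ j * (\<bar>slice i c j \<alpha>\<bar> * mono_at I (\<lambda>_. \<rho>) \<alpha>)) summable_on UNIV \<times> (I \<rightarrow>\<^sub>E UNIV)"
  using c[unfolded pnorm_summable_def] summable_on_reindex_bij_betw[OF bij_betw_PiE_insert[OF I(2)],
      of "\<lambda>\<alpha>. \<bar>c \<alpha>\<bar> * mono_at (insert i I) (\<lambda>_. \<rho>) \<alpha>"]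
  by (simp add: case_prod_unfold mono_at_insert[OF I] slice_def mult_ac)

lemma pnorm_summable_slice: "pnorm_summable I \<rho> (slice i c j)"
proof -
  have "(\<lambda>\<alpha>. inverse (\<rho> ^ j) * (\<rho> ^ j * (\<bar>slice i c j \<alpha>\<bar> * mono_at I (\<lambda>_. \<rho>) \<alpha>))) summable_on (I \<rightarrow>\<^sub>E UNIV)"
    using summable_on_SigmaD1[OF pnorm_slice_summable2, of j] by (intro summable_on_cmult_right[where c="inverse (\<rho> ^ j)"]) simp
  moreover have "inverse (\<rho> ^ j) * (\<rho> ^ j * y) = y" for y using \<rho> by simp
  ultimately show ?thesis by (simp only: pnorm_summable_def)
qed

lemma pnorm_slices_summable: "(\<lambda>j. pnorm I \<rho> (slice i c j) * \<rho> ^ j) summable_on UNIV"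
  using summable_on_Sigma_banach[OF pnorm_slice_summable2]
  by (simp add: pnorm_def infsum_cmult_right' mult.commute)

text \<open>A Cauchy estimate: a single term of a convergent series of nonnegative terms is at most
  the sum. It supplies the geometric growth in \<open>j\<close> of the bounds in the division
  argument.\<close>

lemma pnorm_slice_le:
  obtains K where "0 \<le> K" "\<And>j. pnorm I \<rho> (slice i c j) \<le> K * (1 / \<rho>) ^ j"
proof
  let ?f = "\<lambda>j. pnorm I \<rho> (slice i c j) * \<rho> ^ j"
  show "0 \<le> infsum ?f UNIV" using \<rho> by (intro infsum_nonneg) (simp add: pnorm_nonneg)
  fix j
  have "sum ?f {j} \<le> infsum ?f UNIV"
    using \<rho> by (intro finite_sum_le_infsum[OF pnorm_slices_summable]) (auto simp: pnorm_nonneg)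
  then show "pnorm I \<rho> (slice i c j) \<le> infsum ?f UNIV * (1 / \<rho>) ^ j"
    using \<rho> by (simp add: power_one_over field_simps)
qed

lemma abs_pser_slices_summable:
  assumes "\<And>k. k \<in> I \<Longrightarrow> \<bar>x k\<bar> \<le> \<rho>"
  shows "(\<lambda>j. \<bar>pser I (slice i c j) x\<bar> * \<rho> ^ j) summable_on UNIV"
  by (rule summable_on_real_comparison[OF pnorm_slices_summable])
     (use abs_pser_le[OF pnorm_summable_slice assms] \<rho> in \<open>auto simp: abs_mult intro!: mult_right_mono\<close>)

lemma pser_insert:
  assumes x: "\<And>k. k \<in> insert i I \<Longrightarrow> \<bar>x k\<bar> \<le> \<rho>"
  shows "((\<lambda>j. pser I (slice i c j) x * x i ^ j) has_sum pser (insert i I) c x) UNIV"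
proof -
  let ?f = "\<lambda>j \<alpha>. x i ^ j * (slice i c j \<alpha> * mono_at I x \<alpha>)"
  have eq: "(\<lambda>\<alpha>. c \<alpha> * mono_at (insert i I) x \<alpha>) (case p of (j, \<alpha>) \<Rightarrow> \<alpha>(i := j)) = case_prod ?f p" for p
    by (simp add: case_prod_unfold mono_at_insert[OF I] slice_def mult_ac)
  have s: "case_prod ?f summable_on UNIV \<times> (I \<rightarrow>\<^sub>E UNIV)"
    using pser_summable[OF c x] summable_on_reindex_bij_betw[OF bij_betw_PiE_insert[OF I(2)],
        of "\<lambda>\<alpha>. c \<alpha> * mono_at (insert i I) x \<alpha>"]
    unfolding eq by simp
  have "pser (insert i I) c x = infsum (case_prod ?f) (UNIV \<times> (I \<rightarrow>\<^sub>E UNIV))"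
    using infsum_reindex_bij_betw[OF bij_betw_PiE_insert[OF I(2)],
        of "\<lambda>\<alpha>. c \<alpha> * mono_at (insert i I) x \<alpha>"]
    unfolding pser_def eq by simp
  moreover have row: "infsum (?f j) (I \<rightarrow>\<^sub>E UNIV) = pser I (slice i c j) x * x i ^ j" for j
    by (simp add: pser_def infsum_cmult_right' mult.commute)
  ultimately show ?thesis
    using infsum_Sigma'_banach[OF s] summable_on_Sigma_banach[OF s] unfolding row
    by (simp add: has_sum_iff)
qed

end

section \<open>Zero sets of power series\<close>

text \<open>The series extends to a holomorphic function on the complex disc of radius \<rho>, and a
  nonconstant holomorphic function there has only countably many zeros.\<close>

lemma power_series_countable_zeros:
  fixes b :: "nat \<Rightarrow> real"
  assumes b: "summable (\<lambda>j. \<bar>b j\<bar> * \<rho> ^ j)" and ne: "b m \<noteq> 0"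
  shows "countable {t. \<bar>t\<bar> < \<rho> \<and> (\<Sum>j. b j * t ^ j) = 0}"
proof (cases "0 < \<rho>")
  case False
  then have "{t. \<bar>t\<bar> < \<rho> \<and> (\<Sum>j. b j * t ^ j) = 0} = {}" by auto
  then show ?thesis by (simp only: countable_empty)
next
  case \<rho>: True
  define f where "f z = (\<Sum>j. of_real (b j) * z ^ j)" for z :: complex
  have sm: "summable (\<lambda>j. of_real (b j) * z ^ j)" if "z \<in> ball 0 \<rho>" for z :: complex
  proof (rule summable_comparison_test'[OF b])
    fix j show "norm (of_real (b j) * z ^ j) \<le> \<bar>b j\<bar> * \<rho> ^ j"
      using that by (auto simp: norm_mult norm_power intro!: mult_left_mono power_mono)
  qed
  have sums: "(\<lambda>j. of_real (b j) * (z - 0) ^ j) sums f z" if "z \<in> ball 0 \<rho>" for z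
    using sm[OF that] unfolding f_def by (simp add: summable_sums)
  have hol: "f holomorphic_on ball 0 \<rho>"
    by (rule power_series_holomorphic[OF sums])
  \<comment> \<open>A constant function with a zero vanishes on the whole disc. Then
    \<open>b 0 = 0\<close>, so \<open>m\<close> is positive, and the nonzero coefficient
    \<open>b m\<close> makes 0 an isolated zero, a contradiction.\<close>
  have "\<not> f constant_on ball 0 \<rho> \<or> (\<forall>z\<in>ball 0 \<rho>. f z \<noteq> 0)"
  proof (rule ccontr)
    assume "\<not> ?thesis"
    then have 0: "f z = 0" if "z \<in> ball 0 \<rho>" for z
      using that unfolding constant_on_def by metis
    have "f 0 = of_real (b 0)" unfolding f_def by (rule powser_zero)
    then have "0 < m" using ne 0[of 0] \<rho> by (auto intro: gr0I)
    then obtain s where "0 < s" "\<And>z. z \<in> cball 0 s - {0} \<Longrightarrow> f z \<noteq> 0"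
      using powser_0_nonzero[of \<rho> "0::complex" "\<lambda>j. of_real (b j)" f m] \<rho> sums ne 0[of 0]
      by auto
    moreover have "0 < min s (\<rho> / 2)" "min s (\<rho> / 2) \<le> s" "min s (\<rho> / 2) < \<rho>"
      using \<rho> \<open>0 < s\<close> by auto
    ultimately show False using 0[of "of_real (min s (\<rho> / 2))"] by (simp del: min_less_iff_disj min_less_iff_conj)
  qed
  moreover have "fsigma (ball 0 \<rho> :: complex set)"
  proof -
    have "z \<in> (\<Union>n. cball 0 (\<rho> - inverse (real (Suc n))))" if "z \<in> ball 0 \<rho>" for z :: complex
    proof -
      have "0 < \<rho> - norm z" using that by simp
      then obtain n where "inverse (real (Suc n)) < \<rho> - norm z" by (rule reals_Archimedean[THEN exE])
      then have "norm z \<le> \<rho> - inverse (real (Suc n))" by linarith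
      then show ?thesis by (intro UN_I[of n]) (simp_all only: mem_cball_0 UNIV_I)
    qed
    moreover have "cball 0 (\<rho> - inverse (real (Suc n))) \<subseteq> (ball 0 \<rho> :: complex set)" for n
    proof
      fix z :: complex assume "z \<in> cball 0 (\<rho> - inverse (real (Suc n)))"
      moreover have "\<rho> - inverse (real (Suc n)) < \<rho>" by simp
      ultimately show "z \<in> ball 0 \<rho>" unfolding mem_cball_0 mem_ball_0 by (rule le_less_trans)
    qed
    ultimately have "ball 0 \<rho> = (\<Union>n. cball 0 (\<rho> - inverse (real (Suc n))) :: complex set)" by blast
    then show ?thesis using fsigma.intros[of "\<lambda>n. cball 0 (\<rho> - inverse (real (Suc n)))"] by simp
  qed
  ultimately have cnt: "countable {z\<in>ball 0 \<rho>. f z = 0}"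
  proof (elim disjE)
    assume "\<not> f constant_on ball 0 \<rho>" "fsigma (ball 0 \<rho> :: complex set)"
    then show ?thesis by (intro holomorphic_countable_zeros hol) auto
  next
    assume "\<forall>z\<in>ball 0 \<rho>. f z \<noteq> 0"
    then have "{z\<in>ball 0 \<rho>. f z = 0} = {}" by blast
    then show ?thesis by (simp only: countable_empty)
  qed
  have f_real: "f (of_real t) = of_real (\<Sum>j. b j * t ^ j)" if "\<bar>t\<bar> < \<rho>" for t
  proof -
    have "summable (\<lambda>j. complex_of_real (b j * t ^ j))" using sm[of "of_real t"] that by simp
    then have "summable (\<lambda>j. b j * t ^ j)" by (simp only: summable_complex_of_real)
    then show ?thesis unfolding f_def by (subst suminf_of_real) auto
  qed
  have "of_real ` {t. \<bar>t\<bar> < \<rho> \<and> (\<Sum>j. b j * t ^ j) = 0} \<subseteq> {z\<in>ball 0 \<rho>. f z = 0}"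
    using f_real by auto
  from countable_subset[OF this cnt] show ?thesis
    by (rule countable_image_inj_on) (auto intro: inj_onI)
qed

text \<open>A nonempty open interval is uncountable, whereas a series with a nonzero coefficient has
  only countably many zeros.\<close>

lemma power_series_eq_0D:
  fixes b :: "nat \<Rightarrow> real"
  assumes b: "summable (\<lambda>j. \<bar>b j\<bar> * \<rho> ^ j)" and \<eta>: "0 < \<eta>" "\<eta> \<le> \<rho>"
    and zero: "\<And>t. \<bar>t\<bar> < \<eta> \<Longrightarrow> (\<Sum>j. b j * t ^ j) = 0"
  shows "b m = 0"
proof (rule ccontr)
  assume "b m \<noteq> 0"
  then have "countable {t. \<bar>t\<bar> < \<rho> \<and> (\<Sum>j. b j * t ^ j) = 0}"
    by (rule power_series_countable_zeros[OF b])
  moreover have "{-\<eta><..<\<eta>} \<subseteq> {t. \<bar>t\<bar> < \<rho> \<and> (\<Sum>j. b j * t ^ j) = 0}"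
    using zero \<eta> by (auto simp: abs_less_iff)
  ultimately have "countable {-\<eta><..<\<eta>}" by (rule countable_subset[rotated])
  then show False using \<eta> uncountable_open_interval[of "-\<eta>" \<eta>] by simp
qed

text \<open>Splitting off one variable at a time turns the sum over multi-indices into iterated
  \<open>suminf\<close>, which preserves measurability. Agreement is claimed only on the cube where
  convergence is known, and \<open>restrict\<close> makes the argument a point of the product
  space.\<close>

lemma pser_measurable:
  assumes "finite I" "0 < \<rho>" "pnorm_summable I \<rho> c"
  shows "\<exists>F \<in> borel_measurable (\<Pi>\<^sub>M i\<in>I. lborel). \<forall>x. (\<forall>i\<in>I. \<bar>x i\<bar> \<le> \<rho>) \<longrightarrow> F (restrict x I) = pser I c x"
  using assms(1,3)
proof (induction I arbitrary: c rule: finite_induct)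
  case empty
  have "pser {} c x = c (\<lambda>_. undefined)" for x :: "'a \<Rightarrow> real"
    by (simp add: pser_def mono_at_def)
  then show ?case by (auto intro!: bexI[of _ "\<lambda>_. c (\<lambda>_. undefined)"])
next
  case (insert i I)
  note I = insert.hyps(1,2) and c = insert.prems
  have "\<forall>j. \<exists>F. F \<in> borel_measurable (\<Pi>\<^sub>M i\<in>I. lborel) \<and>
      (\<forall>x. (\<forall>i\<in>I. \<bar>x i\<bar> \<le> \<rho>) \<longrightarrow> F (restrict x I) = pser I (slice i c j) x)"
    using insert.IH[OF pnorm_summable_slice[OF I assms(2) c]] by blast
  then obtain F where F: "\<And>j. F j \<in> borel_measurable (\<Pi>\<^sub>M i\<in>I. lborel)"
    and F_eq: "\<And>j x. (\<And>i. i \<in> I \<Longrightarrow> \<bar>x i\<bar> \<le> \<rho>) \<Longrightarrow> F j (restrict x I) = pser I (slice i c j) x"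
    by metis
  define H where "H x = (\<Sum>j. F j (restrict x I) * x i ^ j)" for x
  have "H \<in> borel_measurable (\<Pi>\<^sub>M i\<in>insert i I. lborel)"
  proof -
    have "(\<lambda>x. F j (restrict x I)) \<in> borel_measurable (\<Pi>\<^sub>M i\<in>insert i I. lborel)" for j
      by (rule measurable_compose[OF measurable_restrict_subset F]) auto
    moreover have "(\<lambda>x. x i) \<in> borel_measurable (\<Pi>\<^sub>M i\<in>insert i I. lborel)"
      using measurable_component_singleton[of i "insert i I" "\<lambda>_. lborel :: real measure"] by simp
    ultimately show ?thesis unfolding H_def
      by (intro borel_measurable_suminf borel_measurable_times borel_measurable_power) auto
  qed
  moreover have "H (restrict x (insert i I)) = pser (insert i I) c x"
    if x: "\<And>k. k \<in> insert i I \<Longrightarrow> \<bar>x k\<bar> \<le> \<rho>" for x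
  proof -
    have "restrict (restrict x (insert i I)) I = restrict x I" by auto
    then have "H (restrict x (insert i I)) = (\<Sum>j. pser I (slice i c j) x * x i ^ j)"
      using F_eq[of x] x by (simp add: H_def)
    also have "\<dots> = pser (insert i I) c x"
      using has_sum_imp_sums[OF pser_insert[where x=x, OF I assms(2) c x]] by (simp add: sums_iff)
    finally show ?thesis .
  qed
  ultimately show ?case by blast
qed

interpretation lborel_product: product_sigma_finite "\<lambda>_. lborel :: real measure"
  by standard

text \<open>Let \<open>j\<close> be the exponent of the new variable in a nonzero term. The
  \<open>j\<close>-th slice is a nonzero series, so by induction its zero set \<open>Y\<close> is
  null. Over a point outside \<open>Y\<close> the fibre of the zero set is countable, and
  integrating over the fibres gives measure 0. With no variables the series is a nonzero
  constant.\<close>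

lemma pser_zeros_null:
  assumes "finite I" "0 < \<rho>" "pnorm_summable I \<rho> c" "\<alpha> \<in> I \<rightarrow>\<^sub>E UNIV" "c \<alpha> \<noteq> 0"
  shows "{x \<in> I \<rightarrow>\<^sub>E UNIV. (\<forall>i\<in>I. \<bar>x i\<bar> < \<rho>) \<and> pser I c x = 0} \<in> null_sets (\<Pi>\<^sub>M i\<in>I. lborel)"
  using assms(1,3-5)
proof (induction I arbitrary: c \<alpha> rule: finite_induct)
  case empty
  then have "{x \<in> {} \<rightarrow>\<^sub>E UNIV. (\<forall>i\<in>{}. \<bar>x i\<bar> < \<rho>) \<and> pser {} c x = 0} = {}"
    by (auto simp: pser_def mono_at_def)
  then show ?case by (simp only: null_sets.empty_sets)
next
  case (insert i I)
  note I = insert.hyps(1,2) and c = insert.prems(1)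
  let ?M = "\<lambda>I. \<Pi>\<^sub>M i\<in>I. (lborel :: real measure)"
  define Z where "Z = {x \<in> insert i I \<rightarrow>\<^sub>E UNIV. (\<forall>k\<in>insert i I. \<bar>x k\<bar> < \<rho>) \<and> pser (insert i I) c x = 0}"
  define j where "j = \<alpha> i"
  define Y where "Y = {x \<in> I \<rightarrow>\<^sub>E UNIV. (\<forall>k\<in>I. \<bar>x k\<bar> < \<rho>) \<and> pser I (slice i c j) x = 0}"
  have Y: "Y \<in> null_sets (?M I)" unfolding Y_def
  proof (rule insert.IH[OF pnorm_summable_slice[OF I assms(2) c]])
    show "restrict \<alpha> I \<in> I \<rightarrow>\<^sub>E UNIV" by simp
    have "(restrict \<alpha> I)(i := j) = \<alpha>"
      using insert.prems(2) by (auto simp: j_def fun_eq_iff PiE_def extensional_def)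
    then show "slice i c j (restrict \<alpha> I) \<noteq> 0" using insert.prems(3) by (simp add: slice_def)
  qed
  have Z_meas: "Z \<in> sets (?M (insert i I))"
  proof -
    obtain F where F: "F \<in> borel_measurable (?M (insert i I))"
      and F_eq: "\<And>x. (\<And>k. k \<in> insert i I \<Longrightarrow> \<bar>x k\<bar> \<le> \<rho>) \<Longrightarrow> F (restrict x (insert i I)) = pser (insert i I) c x"
      using pser_measurable[OF _ assms(2) c] I by blast
    have "Z = (insert i I \<rightarrow>\<^sub>E {-\<rho><..<\<rho>}) \<inter> {x \<in> space (?M (insert i I)). F x = 0}"
    proof (intro equalityI subsetI)
      fix x assume x: "x \<in> Z"
      then have "F x = pser (insert i I) c x"
        using F_eq[of x] by (auto simp: Z_def extensional_restrict PiE_def intro: less_imp_le)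
      then show "x \<in> (insert i I \<rightarrow>\<^sub>E {-\<rho><..<\<rho>}) \<inter> {x \<in> space (?M (insert i I)). F x = 0}"
        using x by (auto simp: Z_def space_PiM abs_less_iff PiE_iff)
    next
      fix x assume x: "x \<in> (insert i I \<rightarrow>\<^sub>E {-\<rho><..<\<rho>}) \<inter> {x \<in> space (?M (insert i I)). F x = 0}"
      then have b: "\<bar>x k\<bar> < \<rho>" if "k \<in> insert i I" for k
        using that by (auto simp: PiE_iff abs_less_iff)
      then have "F x = pser (insert i I) c x"
        using F_eq[of x] x by (auto simp: extensional_restrict PiE_def intro: less_imp_le)
      then show "x \<in> Z" using x b by (auto simp: Z_def PiE_iff)
    qed
    moreover have "(insert i I \<rightarrow>\<^sub>E {-\<rho><..<\<rho>}) \<in> sets (?M (insert i I))"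
      using I by (intro sets_PiM_I_finite) auto
    moreover have "{x \<in> space (?M (insert i I)). F x = 0} \<in> sets (?M (insert i I))"
      using F by measurable
    ultimately show ?thesis by (simp only: sets.Int)
  qed
  have inner: "(\<integral>\<^sup>+t. indicator Z (x(i := t)) \<partial>lborel) = 0" if x: "x \<in> I \<rightarrow>\<^sub>E UNIV" "x \<notin> Y" for x
  proof -
    have cnt: "countable {t. x(i := t) \<in> Z}"
    proof (cases "\<forall>k\<in>I. \<bar>x k\<bar> < \<rho>")
      case True
      then have le: "\<bar>x k\<bar> \<le> \<rho>" if "k \<in> I" for k using that by (auto intro: less_imp_le)
      have "summable (\<lambda>j. \<bar>pser I (slice i c j) x\<bar> * \<rho> ^ j)"
        using abs_pser_slices_summable[OF I assms(2) c le] by (rule summable_on_imp_summable)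
      moreover have "pser I (slice i c j) x \<noteq> 0" using x True by (auto simp: Y_def)
      ultimately have "countable {t. \<bar>t\<bar> < \<rho> \<and> (\<Sum>j. pser I (slice i c j) x * t ^ j) = 0}"
        by (rule power_series_countable_zeros)
      moreover have "{t. x(i := t) \<in> Z} \<subseteq> {t. \<bar>t\<bar> < \<rho> \<and> (\<Sum>j. pser I (slice i c j) x * t ^ j) = 0}"
      proof
        fix t assume "t \<in> {t. x(i := t) \<in> Z}"
        then have t: "\<bar>t\<bar> < \<rho>" "pser (insert i I) c (x(i := t)) = 0" by (auto simp: Z_def)
        have "\<bar>(x(i := t)) k\<bar> \<le> \<rho>" if "k \<in> insert i I" for k
          using that t le by auto
        from has_sum_imp_sums[OF pser_insert[where x="x(i := t)", OF I assms(2) c this]]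
        have "(\<lambda>j. pser I (slice i c j) (x(i := t)) * t ^ j) sums 0" using t by simp
        moreover have "pser I (slice i c j) (x(i := t)) = pser I (slice i c j) x" for j
          using I by (intro pser_cong) auto
        ultimately show "t \<in> {t. \<bar>t\<bar> < \<rho> \<and> (\<Sum>j. pser I (slice i c j) x * t ^ j) = 0}"
          using t by (simp add: sums_iff)
      qed
      ultimately show ?thesis by (rule countable_subset[rotated])
    next
      case False
      then have "{t. x(i := t) \<in> Z} = {}" using I by (auto simp: Z_def)
      then show ?thesis by (simp only: countable_empty)
    qed
    have "(\<integral>\<^sup>+t. indicator Z (x(i := t)) \<partial>lborel) = (\<integral>\<^sup>+t. indicator {t. x(i := t) \<in> Z} t \<partial>lborel)"
      by (intro nn_integral_cong) (simp add: indicator_def)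
    also have "\<dots> = emeasure lborel {t. x(i := t) \<in> Z}"
      using cnt by (intro nn_integral_indicator) (simp add: sets.countable)
    also have "\<dots> = 0" using cnt by (rule emeasure_lborel_countable)
    finally show ?thesis .
  qed
  have "emeasure (?M (insert i I)) Z = (\<integral>\<^sup>+x. indicator Z x \<partial>(?M (insert i I)))"
    using Z_meas by simp
  also have "\<dots> = (\<integral>\<^sup>+x. (\<integral>\<^sup>+t. indicator Z (x(i := t)) \<partial>lborel) \<partial>(?M I))"
    using Z_meas by (intro lborel_product.product_nn_integral_insert I) auto
  also have "\<dots> = (\<integral>\<^sup>+x. 0 \<partial>(?M I))"
  proof (intro nn_integral_cong_AE AE_I'[OF Y] subsetI)
    fix x assume "x \<in> {x \<in> space (?M I). (\<integral>\<^sup>+t. indicator Z (x(i := t)) \<partial>lborel) \<noteq> 0}"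
    then show "x \<in> Y" using inner[of x] by (auto simp: space_PiM)
  qed
  finally have "emeasure (?M (insert i I)) Z = 0" by simp
  from null_setsI[OF this Z_meas] show ?case unfolding Z_def .
qed

text \<open>The box has positive measure, so it cannot lie in the null zero set of a nonzero series.
  Its centre \<open>z\<close> is arbitrary within the cube, as needed for spreading zeros in the
  identity theorem.\<close>

lemma pser_eq_0_on_boxD:
  assumes I: "finite I" and \<rho>: "0 < \<rho>" and c: "pnorm_summable I \<rho> c" and \<epsilon>: "0 < \<epsilon>"
    and z: "\<And>i. i \<in> I \<Longrightarrow> \<bar>z i\<bar> + \<epsilon> \<le> \<rho>"
    and zero: "\<And>x. x \<in> I \<rightarrow>\<^sub>E UNIV \<Longrightarrow> (\<And>i. i \<in> I \<Longrightarrow> \<bar>x i - z i\<bar> < \<epsilon>) \<Longrightarrow> pser I c x = 0"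
    and \<alpha>: "\<alpha> \<in> I \<rightarrow>\<^sub>E UNIV"
  shows "c \<alpha> = 0"
proof (rule ccontr)
  assume "c \<alpha> \<noteq> 0"
  let ?box = "Pi\<^sub>E I (\<lambda>i. {z i - \<epsilon> <..< z i + \<epsilon>})"
  have sub: "?box \<subseteq> {x \<in> I \<rightarrow>\<^sub>E UNIV. (\<forall>i\<in>I. \<bar>x i\<bar> < \<rho>) \<and> pser I c x = 0}"
  proof
    fix x assume x: "x \<in> ?box"
    have near: "\<bar>x i - z i\<bar> < \<epsilon>" if "i \<in> I" for i
      using PiE_mem[OF x that] by (auto simp: abs_less_iff)
    have "\<bar>x i\<bar> < \<rho>" if "i \<in> I" for i using near[OF that] z[OF that] by linarith
    then show "x \<in> {x \<in> I \<rightarrow>\<^sub>E UNIV. (\<forall>i\<in>I. \<bar>x i\<bar> < \<rho>) \<and> pser I c x = 0}"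
      using x near zero by (auto simp: PiE_iff)
  qed
  have "?box \<in> sets (\<Pi>\<^sub>M i\<in>I. lborel)" using I by (intro sets_PiM_I_finite) auto
  then have "?box \<in> null_sets (\<Pi>\<^sub>M i\<in>I. lborel)"
    by (rule null_sets_subset[OF pser_zeros_null[OF I \<rho> c \<alpha> \<open>c \<alpha> \<noteq> 0\<close>] _ sub])
  then have "emeasure (\<Pi>\<^sub>M i\<in>I. lborel) ?box = 0" by blast
  moreover have "emeasure (\<Pi>\<^sub>M i\<in>I. lborel) ?box = (\<Prod>i\<in>I. ennreal (2 * \<epsilon>))"
    using I \<epsilon> by (subst lborel_product.emeasure_PiM) (auto intro!: prod.cong)
  ultimately show False using \<epsilon> I by simp
qed

subsection \<open>Encoding multi-indices by primes\<close>

text \<open>Every sequence has a monotone subsequence; a decreasing one in the natural numbers is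
  constant from the place where it attains its minimum.\<close>

lemma nat_seq_nondecreasing_subseq:
  fixes a :: "nat \<Rightarrow> nat"
  obtains r :: "nat \<Rightarrow> nat" where "strict_mono r" "mono (\<lambda>k. a (r k))"
proof -
  obtain f :: "nat \<Rightarrow> nat" where f: "strict_mono f" "monoseq (\<lambda>n. a (f n))" using seq_monosub[of a] by blast
  show thesis
  proof (cases "incseq (\<lambda>n. a (f n))")
    case True
    then show ?thesis using that f by blast
  next
    case False
    then have dec: "decseq (\<lambda>n. a (f n))" using f(2) by (simp add: monoseq_iff)
    obtain n0 where n0: "\<And>n. a (f n0) \<le> a (f n)"
      using ex_has_least_nat[of "\<lambda>_. True" 0 "\<lambda>n. a (f n)"] by auto
    have "a (f (n0 + k)) = a (f n0)" for k
      using n0[of "n0 + k"] decseqD[OF dec, of n0 "n0 + k"] by simp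
    moreover have "strict_mono (\<lambda>k. f (n0 + k))" using f(1) by (simp add: strict_mono_def)
    ultimately show ?thesis using that by (simp add: mono_def)
  qed
qed

lemma seq_nondecreasing_subseq:
  fixes a :: "nat \<Rightarrow> 'i \<Rightarrow> nat"
  assumes "finite I"
  shows "\<exists>r :: nat \<Rightarrow> nat. strict_mono r \<and> (\<forall>i\<in>I. mono (\<lambda>k. a (r k) i))"
  using assms
proof induction
  case empty
  show ?case by (auto intro: exI[of _ id] strict_mono_id)
next
  case (insert i I)
  then obtain r :: "nat \<Rightarrow> nat" where r: "strict_mono r" "\<And>i. i \<in> I \<Longrightarrow> mono (\<lambda>k. a (r k) i)" by blast
  obtain s :: "nat \<Rightarrow> nat" where s: "strict_mono s" "mono (\<lambda>k. a (r (s k)) i)"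
    by (rule nat_seq_nondecreasing_subseq[of "\<lambda>k. a (r k) i"])
  have "mono (\<lambda>k. a (r (s k)) i')" if "i' \<in> I" for i'
    using r(2)[OF that] s(1) by (auto simp: mono_def strict_mono_less_eq)
  moreover have "strict_mono (\<lambda>k. r (s k))" using r(1) s(1) by (simp add: strict_mono_def)
  ultimately show ?case using s(2) by (intro exI[of _ "\<lambda>k. r (s k)"]) auto
qed

text \<open>\<open>F\<close> consists of the minimal elements for the coordinatewise order.
  Infinitely many of them would contain a coordinatewise nondecreasing sequence, hence two
  comparable ones. Among the elements of \<open>A\<close> below \<open>a\<close>, one with least
  coordinate sum is minimal.\<close>

lemma dickson_lemma:
  fixes A :: "('i \<Rightarrow> nat) set"
  assumes I: "finite I" and A: "A \<subseteq> I \<rightarrow>\<^sub>E UNIV"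
  obtains F where "finite F" "F \<subseteq> A" "\<And>a. a \<in> A \<Longrightarrow> \<exists>d\<in>F. \<forall>i\<in>I. d i \<le> a i"
proof
  define F where "F = {d\<in>A. \<forall>b\<in>A. (\<forall>i\<in>I. b i \<le> d i) \<longrightarrow> b = d}"
  show "F \<subseteq> A" by (auto simp: F_def)
  show "finite F"
  proof (rule ccontr)
    assume "infinite F"
    then obtain a :: "nat \<Rightarrow> 'i \<Rightarrow> nat" where a: "inj a" "range a \<subseteq> F"
      using infinite_countable_subset by blast
    obtain r :: "nat \<Rightarrow> nat" where r: "strict_mono r" "\<And>i. i \<in> I \<Longrightarrow> mono (\<lambda>k. a (r k) i)"
      using seq_nondecreasing_subseq[OF I, of a] by blast
    have "\<forall>i\<in>I. a (r 0) i \<le> a (r 1) i" using r(2) by (auto simp: mono_def)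
    moreover have "a n \<in> F" for n using a(2) by blast
    ultimately have "a (r 0) = a (r 1)" unfolding F_def by blast
    then have "r 0 = r 1" using a(1) by (simp add: inj_def)
    then show False using r(1) by (simp add: strict_mono_eq)
  qed
  fix a assume a: "a \<in> A"
  obtain d where d: "d \<in> A" "\<forall>i\<in>I. d i \<le> a i"
    and least: "\<And>b. b \<in> A \<Longrightarrow> \<forall>i\<in>I. b i \<le> a i \<Longrightarrow> sum d I \<le> sum b I"
    using ex_has_least_nat[of "\<lambda>b. b \<in> A \<and> (\<forall>i\<in>I. b i \<le> a i)" a "\<lambda>b. sum b I"] a by auto
  have "b = d" if b: "b \<in> A" "\<forall>i\<in>I. b i \<le> d i" for b
  proof (rule ccontr)
    assume "b \<noteq> d"
    then obtain i where "i \<in> I" "b i \<noteq> d i"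
      using b(1) d(1) A PiE_ext[of b I "\<lambda>_. UNIV" d] by blast
    then have "\<exists>i\<in>I. b i < d i" using b(2) le_neq_implies_less by blast
    then have "sum b I < sum d I"
      using b(2) I by (intro sum_strict_mono_ex1) auto
    moreover have "\<forall>i\<in>I. b i \<le> a i" using b(2) d(2) by (meson le_trans)
    ultimately show False using least b(1) by fastforce
  qed
  then show "\<exists>d\<in>F. \<forall>i\<in>I. d i \<le> a i" using d by (auto simp: F_def)
qed

section \<open>Prime codes and the transfer of the division argument\<close>

definition nth_prime :: "nat \<Rightarrow> nat" where
  "nth_prime = enumerate {p. prime p}"

lemma prime_nth_prime [simp]: "prime (nth_prime i)"
  using enumerate_in_set[OF primes_infinite, of i] by (simp add: nth_prime_def)

lemma nth_prime_neq_0 [simp]: "nth_prime i \<noteq> 0"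
  using prime_nth_prime[of i] not_prime_0 by metis

lemma nth_prime_eq_iff [simp]: "nth_prime i = nth_prime j \<longleftrightarrow> i = j"
  using strict_mono_enumerate[OF primes_infinite] by (simp add: nth_prime_def strict_mono_eq)

definition godel :: "nat set \<Rightarrow> (nat \<Rightarrow> nat) \<Rightarrow> nat" where
  "godel I \<alpha> = (\<Prod>i\<in>I. nth_prime i ^ \<alpha> i)"

definition exponents :: "nat set \<Rightarrow> nat \<Rightarrow> nat \<Rightarrow> nat" where
  "exponents I N = (\<lambda>i\<in>I. multiplicity (nth_prime i) N)"

lemma godel_pos: "0 < godel I \<alpha>"
  unfolding godel_def by (intro prod_pos) (simp add: prime_gt_0_nat)

lemma godel_add: "godel I (\<lambda>i\<in>I. \<alpha> i + \<beta> i) = godel I \<alpha> * godel I \<beta>"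
  unfolding godel_def prod.distrib[symmetric] by (intro prod.cong) (auto simp: power_add)

lemma exponents_godel:
  assumes I: "finite I" and \<alpha>: "\<alpha> \<in> I \<rightarrow>\<^sub>E UNIV"
  shows "exponents I (godel I \<alpha>) = \<alpha>"
proof
  fix i
  show "exponents I (godel I \<alpha>) i = \<alpha> i"
  proof (cases "i \<in> I")
    case True
    have "multiplicity (nth_prime i) (godel I \<alpha>) = (\<Sum>k\<in>I. multiplicity (nth_prime i) (nth_prime k ^ \<alpha> k))"
      unfolding godel_def using I
      by (intro prime_elem_multiplicity_prod_distrib) auto
    also have "\<dots> = (\<Sum>k\<in>I. if k = i then \<alpha> k else 0)"
      by (intro sum.cong refl) (auto simp: prime_multiplicity_other multiplicity_prime_power
          multiplicity_distinct_prime_power)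
    finally show ?thesis using True I by (simp add: exponents_def)
  qed (use \<alpha> in \<open>auto simp: exponents_def PiE_def extensional_def\<close>)
qed

lemma bij_betw_godel:
  assumes "finite I"
  shows "bij_betw (godel I) (I \<rightarrow>\<^sub>E UNIV) (godel I ` (I \<rightarrow>\<^sub>E UNIV))"
  using exponents_godel[OF assms] by (intro inj_on_imp_bij_betw) (metis inj_onI)

text \<open>The encoding turns addition of exponents into multiplication and the coordinatewise
  order into divisibility with a quotient that is again a code. Thus the divisibility axiom is
  Dickson's lemma for the multi-indices.\<close>

lemma dirichlet_evaluation_godel:
  assumes I: "finite I"
  shows "dirichlet_evaluation (godel I ` (I \<rightarrow>\<^sub>E UNIV)) (\<lambda>x N. mono_at I x (exponents I N))"
proof
  let ?S = "godel I ` (I \<rightarrow>\<^sub>E UNIV)"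
  show "0 < N" if "N \<in> ?S" for N using that godel_pos by auto
  fix M N assume "M \<in> ?S" "N \<in> ?S"
  then obtain \<alpha> \<beta> where \<alpha>: "\<alpha> \<in> I \<rightarrow>\<^sub>E UNIV" "M = godel I \<alpha>" and \<beta>: "\<beta> \<in> I \<rightarrow>\<^sub>E UNIV" "N = godel I \<beta>"
    by auto
  have MN: "M * N = godel I (\<lambda>i\<in>I. \<alpha> i + \<beta> i)" by (simp add: godel_add \<alpha> \<beta>)
  then show "M * N \<in> ?S" by auto
  have "exponents I (M * N) = (\<lambda>i\<in>I. \<alpha> i + \<beta> i)" unfolding MN by (intro exponents_godel I) simp
  then show "mono_at I x (exponents I (M * N)) = mono_at I x (exponents I M) * mono_at I x (exponents I N)"
    for x :: "nat \<Rightarrow> real"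
    using exponents_godel[OF I \<alpha>(1)] exponents_godel[OF I \<beta>(1)]
    by (simp add: \<alpha> \<beta> mono_at_def prod.distrib[symmetric] power_add)
next
  fix A assume A: "A \<subseteq> godel I ` (I \<rightarrow>\<^sub>E UNIV)"
  then obtain B where B: "B \<subseteq> I \<rightarrow>\<^sub>E UNIV" "A = godel I ` B" by (auto simp: subset_image_iff)
  obtain F where F: "finite F" "F \<subseteq> B" and le: "\<And>b. b \<in> B \<Longrightarrow> \<exists>d\<in>F. \<forall>i\<in>I. d i \<le> b i"
    using dickson_lemma[OF I B(1)] by blast
  show "\<exists>F. finite F \<and> F \<subseteq> A \<and> (\<forall>a\<in>A. \<exists>d\<in>F. \<exists>q\<in>godel I ` (I \<rightarrow>\<^sub>E UNIV). a = q * d)"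
  proof (intro exI conjI ballI)
    show "finite (godel I ` F)" "godel I ` F \<subseteq> A" using F B by auto
    fix a assume "a \<in> A"
    then obtain b where b: "b \<in> B" "a = godel I b" using B by auto
    obtain d where d: "d \<in> F" "\<And>i. i \<in> I \<Longrightarrow> d i \<le> b i" using le[OF b(1)] by blast
    have "a = godel I (\<lambda>i\<in>I. b i - d i) * godel I d"
      unfolding b(2) godel_add[symmetric] using d(2) by (auto simp: godel_def intro!: prod.cong)
    then show "\<exists>d\<in>godel I ` F. \<exists>q\<in>godel I ` (I \<rightarrow>\<^sub>E UNIV). a = q * d"
      using d(1) by (intro bexI[of _ "godel I d"] bexI[of _ "godel I (\<lambda>i\<in>I. b i - d i)"]) auto
  qed
qed

lemma slices_dominated:
  fixes I :: "nat set"
  assumes I: "finite I" "i \<notin> I" and \<rho>: "0 < \<rho>" and c: "pnorm_summable (insert i I) \<rho> c"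
  obtains \<delta> C k where "0 < \<delta>" "\<delta> \<le> \<rho>" "0 \<le> C"
    and "\<And>x j. (\<And>k. k \<in> I \<Longrightarrow> \<bar>x k\<bar> \<le> \<delta>) \<Longrightarrow>
      \<bar>pser I (slice i c j) x\<bar> \<le> C * (1 / \<rho>) ^ j * (\<Sum>l\<le>k. \<bar>pser I (slice i c l) x\<bar>)"
proof -
  let ?S = "godel I ` (I \<rightarrow>\<^sub>E UNIV)"
  interpret dirichlet_evaluation ?S "\<lambda>x N. mono_at I x (exponents I N)"
    by (rule dirichlet_evaluation_godel[OF I(1)])
  define b where "b j N = slice i c j (exponents I N)" for j N
  have b_godel: "b j (godel I \<alpha>) = slice i c j \<alpha>" if "\<alpha> \<in> I \<rightarrow>\<^sub>E UNIV" for j \<alpha>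
    by (simp add: b_def exponents_godel[OF I(1) that])
  have wt_godel: "wt \<sigma> (godel I \<alpha>) = (\<Prod>i\<in>I. ((1 / real (nth_prime i)) ^ \<sigma>) ^ \<alpha> i)" for \<sigma> \<alpha>
  proof -
    have "1 / real (godel I \<alpha>) = (\<Prod>i\<in>I. (1 / real (nth_prime i)) ^ \<alpha> i)"
      by (simp add: godel_def prod_dividef power_one_over)
    then show ?thesis
      unfolding wt_def by (simp only: prod_power_distrib power_mult[symmetric] mult.commute)
  qed
  \<comment> \<open>All primes are at least 2, so with this exponent the weight of every code is at
    most the value of its monomial at radius \<rho>.\<close>
  obtain \<sigma>0 where \<sigma>0: "(1 / 2 :: real) ^ \<sigma>0 < \<rho>" using real_arch_pow_inv[OF \<rho>, of "1 / 2"] by auto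
  have wt_le: "wt \<sigma>0 (godel I \<alpha>) \<le> mono_at I (\<lambda>_. \<rho>) \<alpha>" for \<alpha>
    unfolding wt_godel mono_at_def
  proof (intro prod_mono conjI power_mono)
    fix k
    have "real (nth_prime k) \<ge> 2" using prime_ge_2_nat[OF prime_nth_prime[of k]] by simp
    then have "(1 / real (nth_prime k)) ^ \<sigma>0 \<le> (1 / 2) ^ \<sigma>0"
      by (intro power_mono divide_left_mono) auto
    then show "(1 / real (nth_prime k)) ^ \<sigma>0 \<le> \<rho>" using \<sigma>0 by simp
  qed auto
  obtain K where K: "0 \<le> K" "\<And>j. pnorm I \<rho> (slice i c j) \<le> K * (1 / \<rho>) ^ j"
    using pnorm_slice_le[OF I \<rho> c] by blast
  have term_sum: "(\<lambda>\<alpha>. \<bar>b j (godel I \<alpha>)\<bar> * wt \<sigma>0 (godel I \<alpha>)) summable_on (I \<rightarrow>\<^sub>E UNIV)" for j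
    using pnorm_summable_slice[OF I \<rho> c, of j] unfolding pnorm_summable_def
    by (rule summable_on_real_comparison) (auto simp: b_godel abs_mult intro!: mult_left_mono wt_le)
  have summ_b: "summ \<sigma>0 (b j)" for j
    using term_sum[of j]
      summable_on_reindex_bij_betw[OF bij_betw_godel[OF I(1)], of "\<lambda>N. \<bar>b j N\<bar> * wt \<sigma>0 N"]
    unfolding summ_def by simp
  have nrm_b: "nrm \<sigma>0 (b j) \<le> K * (1 / \<rho>) ^ j" for j
  proof -
    have "nrm \<sigma>0 (b j) = infsum (\<lambda>\<alpha>. \<bar>b j (godel I \<alpha>)\<bar> * wt \<sigma>0 (godel I \<alpha>)) (I \<rightarrow>\<^sub>E UNIV)"
      unfolding nrm_def by (rule infsum_reindex_bij_betw[OF bij_betw_godel[OF I(1)], symmetric])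
    also have "\<dots> \<le> pnorm I \<rho> (slice i c j)"
      unfolding pnorm_def using pnorm_summable_slice[OF I \<rho> c, of j] unfolding pnorm_summable_def
      by (intro infsum_mono term_sum) (auto simp: b_godel intro!: mult_left_mono wt_le)
    finally show ?thesis using K(2)[of j] by simp
  qed
  have val_b: "val (b j) x = pser I (slice i c j) x" for j x
  proof -
    have "val (b j) x = infsum (\<lambda>\<alpha>. b j (godel I \<alpha>) * mono_at I x (exponents I (godel I \<alpha>))) (I \<rightarrow>\<^sub>E UNIV)"
      unfolding val_def by (rule infsum_reindex_bij_betw[OF bij_betw_godel[OF I(1)], symmetric])
    also have "\<dots> = pser I (slice i c j) x"
      unfolding pser_def by (intro infsum_cong) (simp add: b_godel exponents_godel[OF I(1)])
    finally show ?thesis .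
  qed
  obtain \<sigma> C k where C: "0 \<le> C"
    and dom: "\<And>x j. x \<in> polydisc \<sigma> \<Longrightarrow> \<bar>val (b j) x\<bar> \<le> C * (K * (1 / \<rho>) ^ j) * (\<Sum>l\<le>k. \<bar>val (b l) x\<bar>)"
    by (rule dominated_by_finitely_many[where b = b and K = "\<lambda>j. K * (1 / \<rho>) ^ j", OF summ_b nrm_b]) (rule that)
  \<comment> \<open>\<open>P\<close> bounds every prime in use, so the cube of radius
    \<open>(1 / P) ^ \<sigma>\<close> lies in the polydisc. For empty \<open>I\<close> it equals
    1.\<close>
  define P where "P = (\<Prod>i\<in>I. nth_prime i)"
  define \<delta> where "\<delta> = min \<rho> ((1 / real P) ^ \<sigma>)"
  have P: "0 < P" unfolding P_def by (intro prod_pos) (simp add: prime_gt_0_nat)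
  show thesis
  proof (rule that[of \<delta> "C * K" k])
    show "0 < \<delta>" "\<delta> \<le> \<rho>" using \<rho> P by (auto simp: \<delta>_def)
    fix x j assume x: "\<And>k. k \<in> I \<Longrightarrow> \<bar>x k\<bar> \<le> \<delta>"
    have xk: "\<bar>x k\<bar> \<le> (1 / real (nth_prime k)) ^ \<sigma>" if k: "k \<in> I" for k
    proof -
      have "nth_prime k dvd P" unfolding P_def using I(1) k by (rule dvd_prodI)
      then have "nth_prime k \<le> P" using P by (auto dest: dvd_imp_le)
      then have "(1 / real P) ^ \<sigma> \<le> (1 / real (nth_prime k)) ^ \<sigma>"
        using P by (intro power_mono divide_left_mono) (auto simp: prime_gt_0_nat)
      then show ?thesis using x[OF k] by (simp add: \<delta>_def)
    qed
    have "x \<in> polydisc \<sigma>"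
      unfolding polydisc_def
    proof safe
      fix \<alpha> assume \<alpha>: "\<alpha> \<in> I \<rightarrow>\<^sub>E (UNIV :: nat set)"
      have "\<bar>mono_at I x \<alpha>\<bar> \<le> wt \<sigma> (godel I \<alpha>)"
        unfolding wt_godel mono_at_def abs_prod power_abs using xk by (intro prod_mono conjI power_mono) auto
      then show "\<bar>mono_at I x (exponents I (godel I \<alpha>))\<bar> \<le> wt \<sigma> (godel I \<alpha>)"
        by (simp add: exponents_godel[OF I(1) \<alpha>])
    qed
    from dom[OF this, of j]
    show "\<bar>pser I (slice i c j) x\<bar> \<le> C * K * (1 / \<rho>) ^ j * (\<Sum>l\<le>k. \<bar>pser I (slice i c l) x\<bar>)"
      by (simp add: val_b mult.assoc)
  qed (simp add: C K)
qed

subsection \<open>Real analytic functions\<close>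

lemma funpow_diffs: "(diffs ^^ l) b j = fact (j + l) / fact j * (b (j + l) :: real)"
proof (induction l arbitrary: j)
  case (Suc l)
  have "(diffs ^^ Suc l) b j = real (Suc j) * (fact (Suc j + l) / fact (Suc j) * b (Suc j + l))"
    using Suc.IH[of "Suc j"] diffs_def[of "(diffs ^^ l) b"] by simp
  also have "\<dots> = fact (j + Suc l) / fact j * b (j + Suc l)"
    by (simp add: field_simps del: of_nat_Suc)
  finally show ?case .
qed simp

text \<open>The induction on \<open>l\<close> keeps \<open>t\<close> arbitrary, because
  differentiating once more at \<open>t\<close> needs the formula on a neighbourhood of
  \<open>t\<close>.\<close>

lemma funpow_deriv_power_series:
  fixes b :: "nat \<Rightarrow> real"
  assumes "\<And>t. \<bar>t\<bar> < \<rho> \<Longrightarrow> summable (\<lambda>j. b j * t ^ j)"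
    and "\<And>t. \<bar>t\<bar> < \<rho> \<Longrightarrow> F t = (\<Sum>j. b j * t ^ j)" and "\<bar>t\<bar> < \<rho>"
  shows "summable (\<lambda>j. (diffs ^^ l) b j * t ^ j) \<and> (deriv ^^ l) F t = (\<Sum>j. (diffs ^^ l) b j * t ^ j)"
  using assms(3)
proof (induction l arbitrary: t)
  case 0
  then show ?case using assms(1,2) by simp
next
  case (Suc l)
  have sm: "summable (\<lambda>j. (diffs ^^ l) b j * s ^ j)" if "norm s < \<rho>" for s
    using Suc.IH that by simp
  have "((\<lambda>s. \<Sum>j. (diffs ^^ l) b j * s ^ j) has_field_derivative (\<Sum>j. diffs ((diffs ^^ l) b) j * t ^ j)) (at t)"
    using Suc.prems by (intro termdiffs_strong'[OF sm]) auto
  then have "((deriv ^^ l) F has_field_derivative (\<Sum>j. diffs ((diffs ^^ l) b) j * t ^ j)) (at t)"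
    by (rule has_field_derivative_transform_within_open[of _ _ _ "{-\<rho><..<\<rho>}"])
       (use Suc in \<open>auto simp: abs_less_iff\<close>)
  then have "(deriv ^^ Suc l) F t = (\<Sum>j. (diffs ^^ Suc l) b j * t ^ j)"
    by (simp add: DERIV_imp_deriv)
  moreover have "summable (\<lambda>j. (diffs ^^ Suc l) b j * t ^ j)"
    using termdiff_converges[of t \<rho> "(diffs ^^ l) b"] sm Suc.prems by simp
  ultimately show ?case by blast
qed

lemma funpow_partial_deriv:
  "(partial_deriv n ^^ l) g (x(n := t)) = (deriv ^^ l) (\<lambda>s. g (x(n := s))) t"
proof (induction l arbitrary: t)
  case (Suc l)
  have "(partial_deriv n ^^ Suc l) g (x(n := t)) = partial_deriv n ((partial_deriv n ^^ l) g) (x(n := t))"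
    by simp
  also have "\<dots> = deriv (\<lambda>s. (partial_deriv n ^^ l) g (x(n := s))) t"
    unfolding partial_deriv_def[of n "(partial_deriv n ^^ l) g"] by (simp only: fun_upd_upd fun_upd_same)
  also have "\<dots> = (deriv ^^ Suc l) (\<lambda>s. g (x(n := s))) t"
    by (simp only: Suc.IH funpow.simps o_apply)
  finally show ?case .
qed simp

text \<open>The quotient is \<open>fact l\<close> times a binomial coefficient, which is at most
  \<open>2 ^ (j + l)\<close>. This is the source of the factor 2 in \<open>2 * R\<close>
  below.\<close>

lemma fact_ratio_le: "(fact (j + l) / fact j :: real) \<le> fact l * 2 ^ (j + l)"
proof -
  have "(fact (j + l) / fact j :: real) = fact l * real ((j + l) choose l)"
    using binomial_fact[of l "j + l", where ?'a = real] by simp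
  also have "real ((j + l) choose l) \<le> 2 ^ (j + l)"
    using binomial_le_pow2[of "j + l" l] by (metis of_nat_le_iff of_nat_numeral of_nat_power)
  finally show ?thesis by simp
qed

text \<open>The constant term of the \<open>l\<close>-th derivative is \<open>fact l * b l\<close>.
  The remaining terms are dominated by a geometric series with ratio at most 1/2, whose sum the
  second smallness condition keeps below half of that constant term.\<close>

lemma power_series_deriv_almost_constant:
  fixes b :: "nat \<Rightarrow> real"
  assumes sm: "\<And>t. \<bar>t\<bar> < \<rho> \<Longrightarrow> summable (\<lambda>j. b j * t ^ j)"
    and F: "\<And>t. \<bar>t\<bar> < \<rho> \<Longrightarrow> F t = (\<Sum>j. b j * t ^ j)"
    and bl: "b l \<noteq> 0" and b: "\<And>j. \<bar>b j\<bar> \<le> C * R ^ j * \<bar>b l\<bar>"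
    and R: "0 < R" and C: "0 \<le> C" and \<eta>: "0 < \<eta>" "\<eta> \<le> \<rho>"
    and small: "2 * R * \<eta> \<le> 1 / 2" "C * (2 * R) ^ l * (2 * (2 * R * \<eta>)) < 1 / 2"
    and t: "\<bar>t\<bar> < \<eta>"
  shows "(deriv ^^ l) F 0 \<noteq> 0"
    and "\<bar>(deriv ^^ l) F t - (deriv ^^ l) F 0\<bar> < 1 / 2 * \<bar>(deriv ^^ l) F 0\<bar>"
proof -
  define d where "d = (diffs ^^ l) b"
  define q where "q = 2 * R * \<bar>t\<bar>"
  define A where "A = fact l * \<bar>b l\<bar> * (C * (2 * R) ^ l)"
  have q: "0 \<le> q" "q \<le> 2 * R * \<eta>" using R t by (auto simp: q_def intro!: mult_left_mono)
  then have q_half: "q \<le> 1 / 2" using small(1) by linarith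
  have D: "summable (\<lambda>j. d j * s ^ j) \<and> (deriv ^^ l) F s = (\<Sum>j. d j * s ^ j)" if "\<bar>s\<bar> < \<rho>" for s
    unfolding d_def using sm F that by (rule funpow_deriv_power_series)
  have d_t: "summable (\<lambda>j. d j * t ^ j)" "(deriv ^^ l) F t = (\<Sum>j. d j * t ^ j)"
    using D[of t] t \<eta> by auto
  have d_0: "(deriv ^^ l) F 0 = d 0" using D[of 0] \<eta> by simp
  have d0: "d 0 = fact l * b l" by (simp add: d_def funpow_diffs)
  then show "(deriv ^^ l) F 0 \<noteq> 0" using bl d_0 by simp
  have d_le: "\<bar>d j * t ^ j\<bar> \<le> A * q ^ j" for j
  proof -
    have "\<bar>d j * t ^ j\<bar> = fact (j + l) / fact j * \<bar>b (j + l)\<bar> * \<bar>t\<bar> ^ j"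
      by (simp add: d_def funpow_diffs abs_mult power_abs)
    also have "\<dots> \<le> (fact l * 2 ^ (j + l)) * (C * R ^ (j + l) * \<bar>b l\<bar>) * \<bar>t\<bar> ^ j"
      by (intro mult_right_mono mult_mono fact_ratio_le b) auto
    also have "\<dots> = A * q ^ j"
      by (simp add: A_def q_def power_add power_mult_distrib algebra_simps)
    finally show ?thesis .
  qed
  have geo: "summable (\<lambda>j. A * q ^ Suc j)"
    using q q_half by (intro summable_mult summable_Suc_iff[THEN iffD2] summable_geometric) auto
  have "(\<Sum>j. d j * t ^ j) = d 0 + (\<Sum>j. d (Suc j) * t ^ Suc j)"
    using suminf_split_head[OF d_t(1)] by simp
  then have "\<bar>(deriv ^^ l) F t - (deriv ^^ l) F 0\<bar> = \<bar>\<Sum>j. d (Suc j) * t ^ Suc j\<bar>"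
    by (simp add: d_t d_0)
  also have "\<dots> \<le> (\<Sum>j. A * q ^ Suc j)"
    using norm_suminf_le[of "\<lambda>j. d (Suc j) * t ^ Suc j" "\<lambda>j. A * q ^ Suc j"] d_le geo
    by (simp only: real_norm_def)
  also have "\<dots> = A * (q * (1 / (1 - q)))"
    using suminf_geometric[of q] q q_half
    by (simp add: suminf_mult suminf_mult[of "\<lambda>j. q ^ j" q] summable_geometric summable_mult)
  \<comment> \<open>Since \<open>q\<close> is at most 1/2, the factor \<open>1 / (1 - q)\<close> is
    at most 2.\<close>
  also have "\<dots> \<le> A * (q * 2)"
    using C R q q_half by (intro mult_left_mono) (auto simp: A_def divide_simps)
  also have "\<dots> \<le> A * (2 * R * \<eta> * 2)"
    using C R q by (intro mult_left_mono) (auto simp: A_def)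
  also have "\<dots> = fact l * \<bar>b l\<bar> * (C * (2 * R) ^ l * (2 * (2 * R * \<eta>)))"
    by (simp add: A_def)
  also have "\<dots> < fact l * \<bar>b l\<bar> * (1 / 2)"
    using bl small(2) by (intro mult_strict_left_mono) auto
  also have "\<dots> = 1 / 2 * \<bar>(deriv ^^ l) F 0\<bar>"
    by (simp add: d_0 d0 abs_mult)
  finally show "\<bar>(deriv ^^ l) F t - (deriv ^^ l) F 0\<bar> < 1 / 2 * \<bar>(deriv ^^ l) F 0\<bar>" .
qed

text \<open>Take \<open>l\<close> with the largest coefficient among the first \<open>k + 1\<close>;
  their sum is then at most \<open>k + 1\<close> times it. If it were 0, the bound would make all
  coefficients vanish.\<close>

lemma dominant_coefficient:
  fixes b :: "nat \<Rightarrow> real"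
  assumes b: "\<And>j. \<bar>b j\<bar> \<le> C * R ^ j * (\<Sum>l\<le>k. \<bar>b l\<bar>)" and C: "0 \<le> C" and R: "0 < R"
    and ne: "b m \<noteq> 0"
  obtains l where "l \<le> k" "b l \<noteq> 0" "\<And>j. \<bar>b j\<bar> \<le> C * real (Suc k) * R ^ j * \<bar>b l\<bar>"
proof -
  have "Max ((\<lambda>l. \<bar>b l\<bar>) ` {..k}) \<in> (\<lambda>l. \<bar>b l\<bar>) ` {..k}" by (intro Max_in) auto
  then obtain l where l: "l \<le> k" "Max ((\<lambda>l. \<bar>b l\<bar>) ` {..k}) = \<bar>b l\<bar>"
    unfolding image_iff atMost_iff bex_simps by blast
  have le: "\<bar>b i\<bar> \<le> \<bar>b l\<bar>" if "i \<le> k" for i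
    unfolding l(2)[symmetric] using that by (intro Max_ge) auto
  have "(\<Sum>i\<le>k. \<bar>b i\<bar>) \<le> real (Suc k) * \<bar>b l\<bar>"
    using sum_bounded_above[of "{..k}" "\<lambda>i. \<bar>b i\<bar>" "\<bar>b l\<bar>"] le by simp
  then have bound: "\<bar>b j\<bar> \<le> C * real (Suc k) * R ^ j * \<bar>b l\<bar>" for j
    using b[of j] mult_left_mono[of "\<Sum>i\<le>k. \<bar>b i\<bar>" "real (Suc k) * \<bar>b l\<bar>" "C * R ^ j"] C R
    by (simp add: mult_ac del: of_nat_Suc)
  moreover have "b l \<noteq> 0" using bound[of m] ne by auto
  ultimately show thesis using l(1) that by blast
qed

section \<open>Cubes, local expansions and the identity theorem\<close>

text \<open>The Euclidean norm is at most the sum of the absolute coordinates. Dividing by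
  \<open>n + 1\<close> instead of \<open>n\<close> makes the inequality strict and covers
  \<open>n = 0\<close>.\<close>

lemma closed_cube_subset_Rn_ball:
  assumes "0 < r" "x \<in> Rn n" "\<And>i. i \<in> {1..n} \<Longrightarrow> \<bar>x i - a i\<bar> \<le> r / real (n + 1)"
  shows "x \<in> Rn_ball n a r"
proof -
  have "L2_set (\<lambda>i. x i - a i) {1..n} \<le> (\<Sum>i\<in>{1..n}. \<bar>x i - a i\<bar>)" by (rule L2_set_le_sum_abs)
  also have "\<dots> \<le> real n * (r / real (n + 1))"
    using sum_bounded_above[of "{1..n}" "\<lambda>i. \<bar>x i - a i\<bar>" "r / real (n + 1)"] assms(3) by simp
  also have "\<dots> < r" using assms(1) by (simp add: field_simps)
  finally show ?thesis using assms(2) by (simp add: Rn_ball_def)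
qed

lemma Rn_ball_coord_less:
  assumes "x \<in> Rn_ball n a r" "i \<in> {1..n}"
  shows "\<bar>x i - a i\<bar> < r"
proof -
  have "\<bar>x i - a i\<bar> \<le> L2_set (\<lambda>i. \<bar>x i - a i\<bar>) {1..n}"
    using assms(2) by (intro member_le_L2_set) auto
  then show ?thesis using assms(1) by (simp add: Rn_ball_def L2_set_def)
qed

lemma real_analytic_onE:
  assumes g: "real_analytic_on n g U" and a: "a \<in> U" and \<epsilon>: "0 < \<epsilon>"
  obtains \<rho> c where "0 < \<rho>" "\<rho> \<le> \<epsilon>" "pnorm_summable {1..n} \<rho> c"
    "\<And>x. x \<in> Rn n \<Longrightarrow> (\<And>i. i \<in> {1..n} \<Longrightarrow> \<bar>x i - a i\<bar> \<le> \<rho>) \<Longrightarrow> g x = pser {1..n} c (\<lambda>i. x i - a i)"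
proof -
  let ?I = "{1..n}"
  obtain r c where r: "0 < r" and c: "\<And>x. x \<in> Rn_ball n a r \<Longrightarrow>
      ((\<lambda>\<alpha>. c \<alpha> * (\<Prod>i\<in>?I. (x i - a i) ^ \<alpha> i)) has_sum g x) (?I \<rightarrow>\<^sub>E UNIV)"
    using g a unfolding real_analytic_on_def by blast
  define \<rho> where "\<rho> = min \<epsilon> (r / real (n + 1))"
  have \<rho>: "0 < \<rho>" "\<rho> \<le> \<epsilon>" "\<rho> \<le> r / real (n + 1)" using \<epsilon> r by (auto simp: \<rho>_def)
  have in_ball: "x \<in> Rn_ball n a r" if "x \<in> Rn n" "\<And>i. i \<in> ?I \<Longrightarrow> \<bar>x i - a i\<bar> \<le> \<rho>" for x
    using closed_cube_subset_Rn_ball[OF r that(1), of a] that(2) \<rho>(3) by force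
  \<comment> \<open>At this corner of the closed cube the monomials are largest in absolute value,
    so absolute convergence there gives \<open>pnorm_summable\<close>.\<close>
  define y where "y = (\<lambda>i\<in>?I. a i + \<rho>)"
  have y: "y \<in> Rn_ball n a r"
    using \<rho>(1) by (intro in_ball) (auto simp: y_def Rn_def)
  have "mono_at ?I (\<lambda>_. \<rho>) \<alpha> = (\<Prod>i\<in>?I. (y i - a i) ^ \<alpha> i)" for \<alpha>
    unfolding mono_at_def by (intro prod.cong) (auto simp: y_def)
  then have "(\<lambda>\<alpha>. c \<alpha> * mono_at ?I (\<lambda>_. \<rho>) \<alpha>) summable_on (?I \<rightarrow>\<^sub>E UNIV)"
    using has_sum_imp_summable[OF c[OF y]] by simp
  then have "(\<lambda>\<alpha>. norm (c \<alpha> * mono_at ?I (\<lambda>_. \<rho>) \<alpha>)) summable_on (?I \<rightarrow>\<^sub>E UNIV)"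
    by (rule summable_on_iff_abs_summable_on_real[THEN iffD1])
  then have "pnorm_summable ?I \<rho> c"
    using \<rho>(1) by (simp add: pnorm_summable_def abs_mult mono_at_nonneg)
  moreover have "g x = pser ?I c (\<lambda>i. x i - a i)" if "x \<in> Rn n" "\<And>i. i \<in> ?I \<Longrightarrow> \<bar>x i - a i\<bar> \<le> \<rho>" for x
    using infsumI[OF c[OF in_ball[OF that]]] by (simp add: pser_def mono_at_def)
  ultimately show thesis using that \<rho> by blast
qed

definition cube :: "nat \<Rightarrow> (nat \<Rightarrow> real) \<Rightarrow> real \<Rightarrow> (nat \<Rightarrow> real) set" where
  "cube n a \<epsilon> = ({1..n} \<rightarrow>\<^sub>E UNIV) \<inter> {x. \<forall>i\<in>{1..n}. \<bar>x i - a i\<bar> < \<epsilon>}"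

lemma openin_cube: "openin (Rn_topology n) (cube n a \<epsilon>)"
proof -
  have "\<bar>x i - a i\<bar> < \<epsilon> \<longleftrightarrow> x i \<in> {a i - \<epsilon><..<a i + \<epsilon>}" for x i
    by (simp only: abs_less_iff greaterThanLessThan_iff) linarith
  then have "cube n a \<epsilon> = Pi\<^sub>E {1..n} (\<lambda>i. {a i - \<epsilon><..<a i + \<epsilon>})"
    unfolding cube_def PiE_iff by (simp add: set_eq_iff PiE_iff conj_commute)
  moreover have "openin (Rn_topology n) (Pi\<^sub>E {1..n} (\<lambda>i. {a i - \<epsilon><..<a i + \<epsilon>}))"
    unfolding Rn_topology_def openin_PiE_gen by auto
  ultimately show ?thesis by simp
qed

lemma openin_contains_cube:
  assumes U: "openin (Rn_topology n) U" and a: "a \<in> U"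
  obtains \<epsilon> where "0 < \<epsilon>" "cube n a \<epsilon> \<subseteq> U"
proof -
  from openin_product_topology_alt[THEN iffD1, rule_format, OF U[unfolded Rn_topology_def] a]
  obtain V where "\<forall>i\<in>{1..n}. openin euclideanreal (V i)" and aV: "a \<in> Pi\<^sub>E {1..n} V"
    and VU: "Pi\<^sub>E {1..n} V \<subseteq> U" by (elim exE conjE)
  then have V: "\<And>i. i \<in> {1..n} \<Longrightarrow> open (V i)" by simp
  have "\<forall>i\<in>{1..n}. \<exists>e>0. \<forall>y. \<bar>y - a i\<bar> < e \<longrightarrow> y \<in> V i"
    using V aV by (auto simp: open_dist dist_real_def PiE_iff)
  then obtain e where e: "\<And>i. i \<in> {1..n} \<Longrightarrow> 0 < e i"
    "\<And>i y. i \<in> {1..n} \<Longrightarrow> \<bar>y - a i\<bar> < e i \<Longrightarrow> y \<in> V i"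
    by metis
  define \<epsilon> where "\<epsilon> = Min (insert 1 (e ` {1..n}))"
  have "0 < \<epsilon>" using e(1) by (auto simp: \<epsilon>_def)
  moreover have "cube n a \<epsilon> \<subseteq> U"
  proof
    fix x assume x: "x \<in> cube n a \<epsilon>"
    have "x i \<in> V i" if i: "i \<in> {1..n}" for i
    proof (rule e(2)[OF i])
      have "\<epsilon> \<le> e i" unfolding \<epsilon>_def using i by (intro Min_le) auto
      then show "\<bar>x i - a i\<bar> < e i" using x i by (force simp: cube_def)
    qed
    then have "x \<in> Pi\<^sub>E {1..n} V" using x by (auto simp: cube_def PiE_iff)
    then show "x \<in> U" using VU by blast
  qed
  ultimately show thesis by (rule that)
qed

lemma pser_eq_0_on_subcubeD:
  assumes \<rho>: "0 < \<rho>" and c: "pnorm_summable {1..n} \<rho> c"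
    and g: "\<And>x. x \<in> Rn n \<Longrightarrow> (\<And>i. i \<in> {1..n} \<Longrightarrow> \<bar>x i - a i\<bar> \<le> \<rho>) \<Longrightarrow> g x = pser {1..n} c (\<lambda>i. x i - a i)"
    and z: "z \<in> cube n a \<rho>" and \<epsilon>: "0 < \<epsilon>" and zero: "\<And>x. x \<in> cube n z \<epsilon> \<Longrightarrow> g x = 0"
    and \<alpha>: "\<alpha> \<in> {1..n} \<rightarrow>\<^sub>E UNIV"
  shows "c \<alpha> = 0"
proof -
  \<comment> \<open>Small enough that the cube around \<open>z\<close> stays inside the cube of
    expansion around \<open>a\<close>. Inserting \<epsilon> also keeps the set nonempty when
    \<open>n = 0\<close>.\<close>
  define \<epsilon>' where "\<epsilon>' = Min (insert \<epsilon> ((\<lambda>i. \<rho> - \<bar>z i - a i\<bar>) ` {1..n}))"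
  have pos: "0 < \<epsilon>'" using \<epsilon> z by (auto simp: \<epsilon>'_def cube_def)
  have le: "\<epsilon>' \<le> \<epsilon>" unfolding \<epsilon>'_def by (intro Min_le) auto
  have le_i: "\<bar>z i - a i\<bar> + \<epsilon>' \<le> \<rho>" if "i \<in> {1..n}" for i
  proof -
    have "\<epsilon>' \<le> \<rho> - \<bar>z i - a i\<bar>" unfolding \<epsilon>'_def using that by (intro Min_le) auto
    then show ?thesis by linarith
  qed
  show ?thesis
  proof (rule pser_eq_0_on_boxD[OF _ \<rho> c pos, of "\<lambda>i. z i - a i", OF _ le_i _ \<alpha>])
    fix x :: "nat \<Rightarrow> real"
    assume x: "\<And>i. i \<in> {1..n} \<Longrightarrow> \<bar>x i - (z i - a i)\<bar> < \<epsilon>'"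
    define y where "y = (\<lambda>i\<in>{1..n}. x i + a i)"
    have yi: "y i = x i + a i" if "i \<in> {1..n}" for i using that by (simp add: y_def)
    have yR: "y \<in> Rn n" by (simp add: y_def Rn_def)
    have "\<bar>y i - z i\<bar> < \<epsilon>" if "i \<in> {1..n}" for i
      using x[OF that] le yi[OF that] by linarith
    then have "y \<in> cube n z \<epsilon>" using yR by (simp add: cube_def Rn_def)
    then have "0 = g y" using zero by simp
    also have "\<dots> = pser {1..n} c (\<lambda>i. y i - a i)"
    proof (rule g[OF yR])
      fix i assume i: "i \<in> {1..n}"
      show "\<bar>y i - a i\<bar> \<le> \<rho>" using x[OF i] le_i[OF i] yi[OF i] by linarith
    qed
    also have "\<dots> = pser {1..n} c x" by (intro pser_cong) (simp add: yi)
    finally show "pser {1..n} c x = 0" by simp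
  qed auto
qed

text \<open>If the cube of expansion around a point of \<open>U\<close> contains a point near which
  \<open>g\<close> vanishes, all coefficients are 0 and \<open>g\<close> vanishes on that cube.
  Hence the cubes around points of \<open>Z\<close> and those around points of \<open>U - Z\<close>
  form open sets that would disconnect \<open>U\<close>.\<close>

theorem real_analytic_identity:
  assumes U: "openin (Rn_topology n) U" "connectedin (Rn_topology n) U"
    and g: "real_analytic_on n g U" and ne: "\<exists>x\<in>U. g x \<noteq> 0" and a: "a \<in> U" and \<epsilon>: "0 < \<epsilon>"
  shows "\<exists>x\<in>cube n a \<epsilon>. g x \<noteq> 0"
proof (rule ccontr)
  assume a_zero: "\<not> (\<exists>x\<in>cube n a \<epsilon>. g x \<noteq> 0)"
  define Z where "Z = {a\<in>U. \<exists>\<epsilon>>0. \<forall>x\<in>cube n a \<epsilon>. g x = 0}"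
  have U_Rn: "U \<subseteq> {1..n} \<rightarrow>\<^sub>E UNIV"
    using openin_subset[OF U(1)] by (simp add: Rn_topology_def)
  have "\<forall>a\<in>U. \<exists>\<rho>>0. \<forall>z\<in>cube n a \<rho> \<inter> Z. \<forall>x\<in>cube n a \<rho>. g x = 0"
  proof
    fix a assume a: "a \<in> U"
    obtain \<rho> c where \<rho>: "0 < \<rho>" and c: "pnorm_summable {1..n} \<rho> c"
      and gc: "\<And>x. x \<in> Rn n \<Longrightarrow> (\<And>i. i \<in> {1..n} \<Longrightarrow> \<bar>x i - a i\<bar> \<le> \<rho>) \<Longrightarrow> g x = pser {1..n} c (\<lambda>i. x i - a i)"
      using real_analytic_onE[OF g a zero_less_one] by blast
    have "g x = 0" if z: "z \<in> cube n a \<rho>" "z \<in> Z" and x: "x \<in> cube n a \<rho>" for z x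
    proof -
      obtain e where e: "0 < e" "\<And>y. y \<in> cube n z e \<Longrightarrow> g y = 0" using z(2) by (auto simp: Z_def)
      have "c \<alpha> = 0" if "\<alpha> \<in> {1..n} \<rightarrow>\<^sub>E UNIV" for \<alpha>
        by (rule pser_eq_0_on_subcubeD[OF \<rho> c gc z(1) e that])
      then have "pser {1..n} c (\<lambda>i. x i - a i) = 0"
        unfolding pser_def by (intro infsum_0) simp
      moreover have "x \<in> Rn n" "\<And>i. i \<in> {1..n} \<Longrightarrow> \<bar>x i - a i\<bar> \<le> \<rho>"
        using x unfolding cube_def Rn_def by (blast, blast intro: less_imp_le)
      ultimately show ?thesis using gc[of x] by simp
    qed
    then show "\<exists>\<rho>>0. \<forall>z\<in>cube n a \<rho> \<inter> Z. \<forall>x\<in>cube n a \<rho>. g x = 0" using \<rho> by blast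
  qed
  then obtain \<rho> where \<rho>: "\<And>a. a \<in> U \<Longrightarrow> 0 < \<rho> a"
    and spread: "\<And>a z x. a \<in> U \<Longrightarrow> z \<in> cube n a (\<rho> a) \<Longrightarrow> z \<in> Z \<Longrightarrow> x \<in> cube n a (\<rho> a) \<Longrightarrow> g x = 0"
    by (metis IntI)
  have self: "b \<in> cube n b (\<rho> b)" if "b \<in> U" for b
    using that U_Rn \<rho>[OF that] by (auto simp: cube_def)
  have cube_Z: "cube n b (\<rho> b) \<inter> U \<subseteq> Z" if b: "b \<in> U" and z: "z \<in> cube n b (\<rho> b)" "z \<in> Z" for b z
  proof
    fix y assume y: "y \<in> cube n b (\<rho> b) \<inter> U"
    obtain e where "0 < e" "cube n y e \<subseteq> cube n b (\<rho> b)"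
      using openin_contains_cube[OF openin_cube, of y n b "\<rho> b"] y by blast
    then show "y \<in> Z" using y spread[OF b z] by (auto simp: Z_def)
  qed
  define E1 where "E1 = (\<Union>b\<in>Z. cube n b (\<rho> b))"
  define E2 where "E2 = (\<Union>b\<in>U - Z. cube n b (\<rho> b))"
  have ZU: "Z \<subseteq> U" by (auto simp: Z_def)
  have "openin (Rn_topology n) E1" "openin (Rn_topology n) E2"
    unfolding E1_def E2_def by (auto intro: openin_cube)
  moreover have "U \<subseteq> E1 \<union> E2" using self by (auto simp: E1_def E2_def)
  moreover have "E1 \<inter> U \<subseteq> Z"
    using cube_Z self ZU unfolding E1_def by blast
  moreover have "E2 \<inter> Z = {}"
    using cube_Z self unfolding E2_def by blast
  moreover have "a \<in> E1 \<inter> U"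
    using a \<epsilon> a_zero self by (auto simp: E1_def Z_def)
  moreover obtain x where x: "x \<in> U" "g x \<noteq> 0" using ne by blast
  have "x \<notin> Z"
  proof
    assume "x \<in> Z"
    then show False using spread[OF x(1) self[OF x(1)] _ self[OF x(1)]] x by blast
  qed
  then have "x \<in> E2 \<inter> U" using x self by (auto simp: E2_def)
  ultimately show False
    using U(2) unfolding connectedin by blast
qed

section \<open>The dichotomy in the last variable and its exceptional set\<close>

theorem theorem2p1:
  fixes n :: nat and g :: "(nat \<Rightarrow> real) \<Rightarrow> real" and U :: "(nat \<Rightarrow> real) set"
  assumes "n \<ge> 1"
    and "openin (Rn_topology n) U" and "connectedin (Rn_topology n) U"
    and "Rn_origin n \<in> U"
    and "real_analytic_on n g U"
    and "\<exists>x\<in>U. g x \<noteq> 0"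
  shows "\<exists>\<eta>::real. \<exists>k::nat. \<eta> > 0 \<and>
    (\<forall>x\<in>Rn_ball (n - 1) (Rn_origin (n - 1)) \<eta>. \<forall>t. \<bar>t\<bar> < \<eta> \<longrightarrow> x(n := t) \<in> U) \<and>
    (\<forall>x\<in>Rn_ball (n - 1) (Rn_origin (n - 1)) \<eta>.
       (\<forall>t. \<bar>t\<bar> < \<eta> \<longrightarrow> g (x(n := t)) = 0) \<or>
       (\<exists>l\<le>k. \<forall>t. \<bar>t\<bar> < \<eta> \<longrightarrow>
          0 < 1/2 * \<bar>(partial_deriv n ^^ l) g (x(n := 0))\<bar> \<and>
          1/2 * \<bar>(partial_deriv n ^^ l) g (x(n := 0))\<bar> < \<bar>(partial_deriv n ^^ l) g (x(n := t))\<bar> \<and>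
          \<bar>(partial_deriv n ^^ l) g (x(n := t))\<bar> < 2 * \<bar>(partial_deriv n ^^ l) g (x(n := 0))\<bar>)) \<and>
    {x \<in> Rn_ball (n - 1) (Rn_origin (n - 1)) \<eta>. \<forall>t. \<bar>t\<bar> < \<eta> \<longrightarrow> g (x(n := t)) = 0}
      \<in> null_sets (Rn_lebesgue (n - 1))"
proof -
  define I where "I = {1..n - 1}"
  have I: "finite I" "n \<notin> I" and In: "insert n I = {1..n}" using assms(1) by (auto simp: I_def)
  have origin: "Rn_origin m i = 0" if "i \<in> {1..m}" for m i using that by (simp add: Rn_origin_def)
  obtain \<epsilon> where \<epsilon>: "0 < \<epsilon>" "cube n (Rn_origin n) \<epsilon> \<subseteq> U"
    by (rule openin_contains_cube[OF assms(2,4)])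
  \<comment> \<open>Keeping \<rho> at most 1 makes \<open>R = 1 / \<rho>\<close> at least 1, so that
    the powers of \<open>2 * R\<close> increase with the exponent.\<close>
  have "0 < min \<epsilon> 1" using \<epsilon>(1) by simp
  then obtain \<rho> c where \<rho>: "0 < \<rho>" "\<rho> \<le> min \<epsilon> 1" and c: "pnorm_summable {1..n} \<rho> c"
    and gc0: "\<And>x. x \<in> Rn n \<Longrightarrow> (\<And>i. i \<in> {1..n} \<Longrightarrow> \<bar>x i - Rn_origin n i\<bar> \<le> \<rho>) \<Longrightarrow>
      g x = pser {1..n} c (\<lambda>i. x i - Rn_origin n i)"
    by (rule real_analytic_onE[OF assms(5,4)]) (rule that, assumption+, blast)
  have gc: "g x = pser {1..n} c x" if x: "x \<in> Rn n" "\<And>i. i \<in> {1..n} \<Longrightarrow> \<bar>x i\<bar> \<le> \<rho>" for x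
  proof -
    have "g x = pser {1..n} c (\<lambda>i. x i - Rn_origin n i)" using x by (intro gc0) (auto simp: origin)
    also have "\<dots> = pser {1..n} c x" by (intro pser_cong) (simp add: origin)
    finally show ?thesis .
  qed
  \<comment> \<open>A point of \<open>U\<close> with nonzero value may be far from the origin. The
    identity theorem provides one inside the cube of expansion.\<close>
  have "\<exists>\<alpha>\<in>{1..n} \<rightarrow>\<^sub>E UNIV. c \<alpha> \<noteq> 0"
  proof (rule ccontr)
    assume "\<not> ?thesis"
    then have zero: "pser {1..n} c x = 0" for x unfolding pser_def by (intro infsum_0) simp
    obtain x where x: "x \<in> cube n (Rn_origin n) \<rho>" "g x \<noteq> 0"
      using real_analytic_identity[OF assms(2,3,5,6,4) \<rho>(1)] by blast
    have "\<bar>x i\<bar> \<le> \<rho>" if "i \<in> {1..n}" for i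
    proof -
      have "\<bar>x i - Rn_origin n i\<bar> < \<rho>" using x(1) that unfolding cube_def by blast
      then show ?thesis by (simp add: origin[OF that])
    qed
    moreover have "x \<in> Rn n" using x(1) by (simp add: cube_def Rn_def)
    ultimately have "g x = 0" using gc[of x] zero by simp
    with x(2) show False by contradiction
  qed
  then obtain \<alpha> where \<alpha>: "\<alpha> \<in> insert n I \<rightarrow>\<^sub>E UNIV" "c \<alpha> \<noteq> 0" unfolding In by blast
  have c': "pnorm_summable (insert n I) \<rho> c" using c by (simp only: In)
  obtain \<delta> C k where \<delta>: "0 < \<delta>" "\<delta> \<le> \<rho>" and C: "0 \<le> C"
    and dom: "\<And>x j. (\<And>k. k \<in> I \<Longrightarrow> \<bar>x k\<bar> \<le> \<delta>) \<Longrightarrow>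
      \<bar>pser I (slice n c j) x\<bar> \<le> C * (1 / \<rho>) ^ j * (\<Sum>l\<le>k. \<bar>pser I (slice n c l) x\<bar>)"
    by (rule slices_dominated[OF I \<rho>(1) c']) (rule that, assumption+, blast)
  define R where "R = 1 / \<rho>"
  define C' where "C' = C * real (Suc k)"
  have R: "1 \<le> R" "0 < R" using \<rho> by (auto simp: R_def)
  have C': "0 \<le> C'" using C by (simp add: C'_def)
  \<comment> \<open>Chosen so that \<open>C' * (2 * R) ^ l\<close> is below \<open>Q / 4\<close> for
    every \<open>l\<close> up to \<open>k\<close>, and so that \<open>Q\<close> is at least 1. Then
    \<open>4 * R * Q * \<eta> \<le> 1\<close> yields both smallness conditions, whichever
    \<open>l\<close> is selected.\<close>
  define Q where "Q = 4 * (C' + 1) * (2 * R) ^ k"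
  have Q: "1 \<le> Q"
  proof -
    have "1 * 1 \<le> (4 * (C' + 1)) * (2 * R) ^ k"
      using C' R by (intro mult_mono one_le_power) auto
    then show ?thesis by (simp add: Q_def)
  qed
  define \<eta> where "\<eta> = min \<delta> (1 / (4 * R * Q))"
  have \<eta>: "0 < \<eta>" "\<eta> \<le> \<delta>" "\<eta> \<le> \<rho>" "\<eta> \<le> \<epsilon>" using \<delta> \<rho> R Q by (auto simp: \<eta>_def)
  have R\<eta>: "2 * R * \<eta> * (2 * Q) \<le> 1"
  proof -
    have "\<eta> \<le> 1 / (4 * R * Q)" by (simp add: \<eta>_def)
    then have "\<eta> * (4 * R * Q) \<le> 1" using R Q by (simp add: pos_le_divide_eq)
    then show ?thesis by (simp add: mult_ac)
  qed
  have small1: "2 * R * \<eta> \<le> 1 / 2"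
  proof -
    have "2 * R * \<eta> * 2 \<le> 2 * R * \<eta> * (2 * Q)" using R \<eta> Q by (intro mult_left_mono) auto
    then show ?thesis using R\<eta> by linarith
  qed
  have small2: "C' * (2 * R) ^ l * (2 * (2 * R * \<eta>)) < 1 / 2" if "l \<le> k" for l
  proof -
    have "C' * (2 * R) ^ l \<le> C' * (2 * R) ^ k"
      using that R C' by (intro mult_left_mono power_increasing) auto
    also have "\<dots> < (C' + 1) * (2 * R) ^ k" using R by simp
    also have "\<dots> = Q / 4" by (simp add: Q_def)
    finally have "C' * (2 * R) ^ l * (2 * (2 * R * \<eta>)) < Q / 4 * (2 * (2 * R * \<eta>))"
      using R \<eta> by (intro mult_strict_right_mono) auto
    also have "\<dots> = 2 * R * \<eta> * (2 * Q) / 4" by simp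
    finally show ?thesis using R\<eta> by linarith
  qed
  define b where "b x j = pser I (slice n c j) x" for x j
  let ?B = "Rn_ball (n - 1) (Rn_origin (n - 1)) \<eta>"
  have xi: "\<bar>x i\<bar> < \<eta>" if "x \<in> ?B" "i \<in> I" for x i
    using Rn_ball_coord_less[OF that[unfolded I_def]] origin[of i "n - 1"] that(2) by (simp add: I_def)
  have xR: "x \<in> I \<rightarrow>\<^sub>E UNIV" if "x \<in> ?B" for x using that by (simp add: Rn_ball_def Rn_def I_def)
  have xt: "x(n := t) \<in> Rn n" if "x \<in> ?B" for x t
    using xR[OF that] unfolding Rn_def In[symmetric] PiE_def by (simp add: extensional_def)
  have xti: "\<bar>(x(n := t)) i\<bar> < r" if "x \<in> ?B" "\<eta> \<le> r" "\<bar>t\<bar> < r" "i \<in> {1..n}" for x t i r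
    using xi[OF that(1), of i] that(2-) unfolding In[symmetric] by auto
  have b_summable: "summable (\<lambda>j. \<bar>b x j\<bar> * \<rho> ^ j)" if x: "x \<in> ?B" for x
    unfolding b_def
  proof (rule summable_on_imp_summable[OF abs_pser_slices_summable[OF I \<rho>(1) c']])
    show "\<bar>x i\<bar> \<le> \<rho>" if "i \<in> I" for i using xi[OF x that] \<eta>(3) by linarith
  qed
  have g_sums: "(\<lambda>j. b x j * t ^ j) sums g (x(n := t))" if x: "x \<in> ?B" and t: "\<bar>t\<bar> < \<rho>" for x t
  proof -
    have le: "\<bar>(x(n := t)) i\<bar> \<le> \<rho>" if "i \<in> insert n I" for i
      using xti[OF x \<eta>(3) t, of i] that In by (simp add: less_imp_le)
    have "(\<lambda>j. pser I (slice n c j) (x(n := t)) * (x(n := t)) n ^ j) sums pser (insert n I) c (x(n := t))"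
      by (rule has_sum_imp_sums[OF pser_insert[where x = "x(n := t)", OF I \<rho>(1) c' le]])
    moreover have "pser I (slice n c j) (x(n := t)) = b x j" for j
      unfolding b_def using I(2) by (intro pser_cong) auto
    moreover have "g (x(n := t)) = pser (insert n I) c (x(n := t))"
      unfolding In using le In by (intro gc xt[OF x]) auto
    ultimately show ?thesis by simp
  qed
  have vanish: "b x j = 0" if x: "x \<in> ?B" and zero: "\<forall>t. \<bar>t\<bar> < \<eta> \<longrightarrow> g (x(n := t)) = 0" for x j
  proof (rule power_series_eq_0D[OF b_summable[OF x] \<eta>(1,3)])
    fix t assume "\<bar>t\<bar> < \<eta>"
    then show "(\<Sum>j. b x j * t ^ j) = 0"
      using g_sums[OF x, of t] zero \<eta>(3) by (simp add: sums_iff)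
  qed
  have in_U: "x(n := t) \<in> U" if x: "x \<in> ?B" and t: "\<bar>t\<bar> < \<eta>" for x t
  proof -
    have "\<bar>(x(n := t)) i - Rn_origin n i\<bar> < \<epsilon>" if "i \<in> {1..n}" for i
      using xti[OF x order.refl t that] \<eta>(4) by (simp add: origin[OF that] del: fun_upd_apply)
    then have "x(n := t) \<in> cube n (Rn_origin n) \<epsilon>"
      using xt[OF x, of t] unfolding cube_def Rn_def by blast
    then show ?thesis using \<epsilon>(2) by blast
  qed
  have dichotomy: "(\<forall>t. \<bar>t\<bar> < \<eta> \<longrightarrow> g (x(n := t)) = 0) \<or>
       (\<exists>l\<le>k. \<forall>t. \<bar>t\<bar> < \<eta> \<longrightarrow>
          0 < 1/2 * \<bar>(partial_deriv n ^^ l) g (x(n := 0))\<bar> \<and>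
          1/2 * \<bar>(partial_deriv n ^^ l) g (x(n := 0))\<bar> < \<bar>(partial_deriv n ^^ l) g (x(n := t))\<bar> \<and>
          \<bar>(partial_deriv n ^^ l) g (x(n := t))\<bar> < 2 * \<bar>(partial_deriv n ^^ l) g (x(n := 0))\<bar>)"
    if x: "x \<in> ?B" for x
  \<comment> \<open>The cases are split by the coefficients: if all vanish, so does \<open>g\<close>
    along the segment; otherwise the uniform bound provides a dominant index.\<close>
  proof (cases "\<forall>j. b x j = 0")
    case True
    then have "g (x(n := t)) = 0" if "\<bar>t\<bar> < \<eta>" for t
      using g_sums[OF x, of t] that \<eta>(3) by (simp add: sums_iff)
    then show ?thesis by blast
  next
    case False
    then obtain m where m: "b x m \<noteq> 0" by blast
    have "\<bar>x i\<bar> \<le> \<delta>" if "i \<in> I" for i using xi[OF x that] \<eta>(2) by linarith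
    then have "\<bar>b x j\<bar> \<le> C * R ^ j * (\<Sum>l\<le>k. \<bar>b x l\<bar>)" for j
      unfolding b_def R_def by (rule dom)
    from dominant_coefficient[OF this C R(2) m, folded C'_def]
    obtain l where l: "l \<le> k" "b x l \<noteq> 0" "\<And>j. \<bar>b x j\<bar> \<le> C' * R ^ j * \<bar>b x l\<bar>" by blast
    define F where "F t = g (x(n := t))" for t
    have F: "summable (\<lambda>j. b x j * t ^ j)" "F t = (\<Sum>j. b x j * t ^ j)" if "\<bar>t\<bar> < \<rho>" for t
      using g_sums[OF x that] by (simp_all add: sums_iff F_def)
    have D: "(partial_deriv n ^^ l) g (x(n := t)) = (deriv ^^ l) F t" for t
      unfolding F_def by (rule funpow_partial_deriv)
    have "0 < 1/2 * \<bar>(deriv ^^ l) F 0\<bar> \<and> 1/2 * \<bar>(deriv ^^ l) F 0\<bar> < \<bar>(deriv ^^ l) F t\<bar> \<and>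
        \<bar>(deriv ^^ l) F t\<bar> < 2 * \<bar>(deriv ^^ l) F 0\<bar>" if t: "\<bar>t\<bar> < \<eta>" for t
    proof -
      have "(deriv ^^ l) F 0 \<noteq> 0"
        and "\<bar>(deriv ^^ l) F t - (deriv ^^ l) F 0\<bar> < 1 / 2 * \<bar>(deriv ^^ l) F 0\<bar>"
        using power_series_deriv_almost_constant[of \<rho> "b x" F, OF F l(2,3) R(2) C' \<eta>(1,3) small1 small2[OF l(1)] t]
        by simp_all
      \<comment> \<open>A deviation below half of the nonzero value at 0 leaves the absolute value
        strictly between 1/2 and 3/2 of it.\<close>
      then show ?thesis by linarith
    qed
    then show ?thesis
      by (intro disjI2 exI[of _ l] conjI[OF l(1)] allI impI) (simp only: D)
  qed
  have null: "{x \<in> ?B. \<forall>t. \<bar>t\<bar> < \<eta> \<longrightarrow> g (x(n := t)) = 0} \<in> null_sets (Rn_lebesgue (n - 1))"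
  proof -
    \<comment> \<open>The slice containing the nonzero coefficient \<open>c \<alpha>\<close> must
      vanish wherever \<open>g\<close> vanishes along the whole segment, so its zero set covers the
      exceptional set.\<close>
    let ?N = "{x \<in> I \<rightarrow>\<^sub>E UNIV. (\<forall>i\<in>I. \<bar>x i\<bar> < \<rho>) \<and> pser I (slice n c (\<alpha> n)) x = 0}"
    have "?N \<in> null_sets (\<Pi>\<^sub>M i\<in>I. lborel)"
    proof (rule pser_zeros_null[OF I(1) \<rho>(1) pnorm_summable_slice[OF I \<rho>(1) c']])
      show "restrict \<alpha> I \<in> I \<rightarrow>\<^sub>E UNIV" by simp
      have "(restrict \<alpha> I)(n := \<alpha> n) = \<alpha>"
        using \<alpha>(1) by (auto simp: fun_eq_iff PiE_def extensional_def)
      then show "slice n c (\<alpha> n) (restrict \<alpha> I) \<noteq> 0" using \<alpha>(2) by (simp add: slice_def)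
    qed
    moreover have "{x \<in> ?B. \<forall>t. \<bar>t\<bar> < \<eta> \<longrightarrow> g (x(n := t)) = 0} \<subseteq> ?N"
    proof (intro subsetI CollectI conjI ballI)
      fix x assume "x \<in> {x \<in> ?B. \<forall>t. \<bar>t\<bar> < \<eta> \<longrightarrow> g (x(n := t)) = 0}"
      then have x: "x \<in> ?B" "\<forall>t. \<bar>t\<bar> < \<eta> \<longrightarrow> g (x(n := t)) = 0" by auto
      show "x \<in> I \<rightarrow>\<^sub>E UNIV" by (rule xR[OF x(1)])
      show "\<bar>x i\<bar> < \<rho>" if "i \<in> I" for i using xi[OF x(1) that] \<eta>(3) by linarith
      show "pser I (slice n c (\<alpha> n)) x = 0" using vanish[OF x] by (simp add: b_def)
    qed
    \<comment> \<open>Containment in a null set suffices because \<open>Rn_lebesgue\<close> is a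
      completed measure.\<close>
    ultimately show ?thesis
      unfolding Rn_lebesgue_def I_def null_sets_completion_iff2 by blast
  qed
  show ?thesis using \<eta>(1) in_U dichotomy null by (intro exI[of _ \<eta>] exI[of _ k] conjI) blast+
qed

end
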